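(* Let $\boldsymbol f:\mathbb{R}^n\times\mathbb{R}^m\to\mathbb{R}^2$ be continuous with range covered by $T$, let $Z\subset\mathbb{R}^n$ be compact and convex, and let $\boldsymbol\xi$ be a random vector with compact support and discrete distribution $P(\boldsymbol\xi=\boldsymbol\xi^k)=p_k$, $k=1,\dots,K$. Let $\mathscr{U}$ be the class of normalized, componentwise non-decreasing, conservative, continuous utility functions on $T$, and assume that every function in $\mathscr{U}$ is concave in each single variable (for every fixed value of the other variable) and Lipschitz continuous with modulus bounded by $L$ with respect to $\|\cdot\|_1$. Let $\mathcal{U}_N$ be the ambiguity set of Type-1 piecewise linear utility functions belonging to $\mathscr{U}$ (see context). Then the inner minimization problem (for $\boldsymbol z\in Z$) $$\min_{u_N\in\mathcal{U}_N}\sum_{k=1}^K p_k\,u_N(\boldsymbol f(\boldsymbol z,\boldsymbol\xi^k))$$ can be reformulated as the following linear program in $\boldsymbol u=(u_{i,j})\in\mathbb{R}^{N_1N_2}$, where $u_{i,j}$ stands for $u_N(x_i,y_j)$: $$\min_{\boldsymbol u}\ \sum_{k=1}^K p_k\sum_{i=1}^{N_1-1}\sum_{j=1}^{N_2-1}\mathbf 1_{T_{i,j}}(\boldsymbol f^k)\Big[u^{1l}_{i,j}(\boldsymbol f^k)\,\mathbf 1_{\Delta^l_{i,j}}(\boldsymbol f^k)+u^{1u}_{i,j}(\boldsymbol f^k)\,\mathbf 1_{\Delta^u_{i,j}}(\boldsymbol f^k)\Big]$$ subject to (1) for $l=1,\dots,M$: $$\sum_{i=1}^{N_1-1}\sum_{j=1}^{N_2-1}\frac{u_{i+1,j+1}-u_{i,j+1}-u_{i+1,j}+u_{i,j}}{x_{i+1}-x_i}\int_{x_i}^{x_{i+1}}\hat\psi_l(x,y_{ij}(x))\,dx+\sum_{i=1}^{N_1-1}\frac{u_{i+1,1}-u_{i,1}}{x_{i+1}-x_i}\int_{x_i}^{x_{i+1}}\psi_{1,l}(x)\,dx+\sum_{j=1}^{N_2-1}\frac{u_{1,j+1}-u_{1,j}}{y_{j+1}-y_j}\int_{y_j}^{y_{j+1}}\psi_{2,l}(y)\,dy\le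 c_l;$$ (2) $\dfrac{u_{i+1,j}-u_{i,j}}{x_{i+1}-x_i}\le\dfrac{u_{i,j}-u_{i-1,j}}{x_i-x_{i-1}}$, $i=2,\dots,N_1-1$, $j=1,\dots,N_2$; (3) $\dfrac{u_{i,j+1}-u_{i,j}}{y_{j+1}-y_j}\le\dfrac{u_{i,j}-u_{i,j-1}}{y_j-y_{j-1}}$, $i=1,\dots,N_1$, $j=2,\dots,N_2-1$; (4) $u_{i+1,j}-u_{i,j}\le L(x_{i+1}-x_i)$, $i=1,\dots,N_1-1$, $j=1,\dots,N_2$; (5) $u_{i,j+1}-u_{i,j}\le L(y_{j+1}-y_j)$, $i=1,\dots,N_1$, $j=1,\dots,N_2-1$; (6) $u_{i+1,j}\ge u_{i,j}$, $i=1,\dots,N_1-1$, $j=1,\dots,N_2$; (7) $u_{i,j+1}\ge u_{i,j}$, $i=1,\dots,N_1$, $j=1,\dots,N_2-1$; (8) $u_{i,j}+u_{i+1,j+1}\le u_{i,j+1}+u_{i+1,j}$, $i=1,\dots,N_1-1$, $j=1,\dots,N_2-1$; (9) $u_{1,1}=0$, $u_{N_1,N_2}=1$. Here $\boldsymbol f^k:=\boldsymbol f(\boldsymbol z,\boldsymbol\xi^k)$ and $y_{ij}(x)$ is the linear function whose graph over $[x_i,x_{i+1}]$ is the main diagonal segment joining $(x_i,y_j)$ and $(x_{i+1},y_{j+1})$.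
   Context: $T=X\times Y=[\underline x,\bar x]\times[\underline y,\bar y]$. $\mathscr{U}$ is the set of continuous functions $u:T\to[0,1]$ that are componentwise non-decreasing; normalized: $u(\underline x,\underline y)=0$, $u(\bar x,\bar y)=1$; conservative: $u(x_0,y_1)+u(x_1,y_0)\ge u(x_0,y_0)+u(x_1,y_1)$ whenever $x_0<x_1$, $y_0<y_1$; such that $u(\cdot,\hat y)$ and $u(\hat x,\cdot)$ are concave for every $\hat y\in Y$, $\hat x\in X$; and $|u(x,y)-u(x',y')|\le L\|(x-x',y-y')\|_1$ for all $(x,y),(x',y')\in T$. Grid: $\underline x=x_1<\dots<x_{N_1}=\bar x$, $\underline y=y_1<\dots<y_{N_2}=\bar y$; $X_1=[x_1,x_2]$, $X_i=(x_i,x_{i+1}]$ ($i\ge2$), $Y_1=[y_1,y_2]$, $Y_j=(y_j,y_{j+1}]$ ($j\ge 2$), $T_{i,j}=X_i\times Y_j$ for $1\le i\le N_1-1$, $1\le j\le N_2-1$. Let $$\Delta^l_{i,j}=\{(x,y):(y-y_j)(x_{i+1}-x_i)\le(y_{j+1}-y_j)(x-x_i)\},\qquad \Delta^u_{i,j}=\mathbb{R}^2\setminus\Delta^l_{i,j},$$ $$u^{1u}_{i,j}(x,y)=\tfrac{y_{j+1}-y}{y_{j+1}-y_j}u_{i,j}+\Big(\tfrac{y-y_j}{y_{j+1}-y_j}-\tfrac{x-x_i}{x_{i+1}-x_i}\Big)u_{i,j+1}+\tfrac{x-x_i}{x_{i+1}-x_i}u_{i+1,j+1},$$ $$u^{1l}_{i,j}(x,y)=\tfrac{x_{i+1}-x}{x_{i+1}-x_i}u_{i,j}+\Big(\tfrac{x-x_i}{x_{i+1}-x_i}-\tfrac{y-y_j}{y_{j+1}-y_j}\Big)u_{i+1,j}+\tfrac{y-y_j}{y_{j+1}-y_j}u_{i+1,j+1}.$$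 The Type-1 piecewise linear function with gridpoint values $(u_{i,j})$ equals $u^{1u}_{i,j}$ on $T_{i,j}\cap\Delta^u_{i,j}$ and $u^{1l}_{i,j}$ on $T_{i,j}\cap\Delta^l_{i,j}$ (each cell is split by its main diagonal). $\mathscr{U}_N\subset\mathscr{U}$ is the set of all Type-1 piecewise linear utility functions over the cells $T_{i,j}$, $i=1,\dots,N_1-1$, $j=1,\dots,N_2-1$. For given functions $\psi_l:T\to\mathbb{R}$ and constants $c_l$, $l=1,\dots,M$, $\mathcal{U}_N:=\{u_N\in\mathscr{U}_N:\int_T u_N\,d\psi_l\le c_l,\ l=1,\dots,M\}$ (Lebesgue–Stieltjes integrals). The integrals that occur are assumed well-defined, and by multivariate integration by parts $\mathcal{U}_N$ is written as $$\mathcal{U}_N=\Big\{u_N\in\mathscr{U}_N:\int_T\hat\psi_l(x,y)\,du_N(x,y)+\int_X\psi_{1,l}(x)\,du_N(x,\underline y)+\int_Y\psi_{2,l}(y)\,du_N(\underline x,y)\le c_l,\ l=1,\dots,M\Big\},$$ with $\hat\psi_l(x,y)=\psi_l(\bar x,\bar y)-\psi_l(x,\bar y)-\psi_l(\bar x,y)+\psi_l(x,y)$, $\psi_{1,l}(x)=\psi_l(\bar x,\bar y)-\psi_l(x,\bar y)-\psi_l(\bar x,\underline y)+\psi_l(x,\underline y)$, $\psi_{2,l}(y)=\psi_l(\bar x,\bar y)-\psi_l(\underline x,\bar y)-\psi_l(\bar x,y)+\psi_l(\underline x,y)$.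
   Formalization: False as stated: conservative plus concave for every fixed value forces equality in (8). Proved instead: LP (1)–(9) is exact if concavity is required only on grid lines; for the class as stated, the LP with (8) as equality is exact. dψ_l is a finite signed measure without mass on the lower/left edges. *)

theory Defs
  imports "HOL-Probability.Probability"
begin

section \<open>Lebesgue--Stieltjes integrals on a rectangle\<close>

definition rect_incr :: "(real \<times> real \<Rightarrow> real) \<Rightarrow> real \<Rightarrow> real \<Rightarrow> real \<Rightarrow> real \<Rightarrow> real" where
  "rect_incr \<psi> x0 x1 y0 y1 = \<psi> (x1, y1) - \<psi> (x0, y1) - \<psi> (x1, y0) + \<psi> (x0, y0)"

text \<open>
  The signed measure \<open>d\<psi>\<close> is given as a difference of two finite Borel measures \<open>M - N\<close> whose
  values on half-open rectangles are the increments of \<open>\<psi>\<close>.  There is no mass on the left and on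
  the lower edge of the domain (\<open>\<psi>\<close> is thought of as extended constantly across these edges).  This
  is the convention under which the integration by parts formula with
  \<open>psi_hat\<close>, \<open>psi_1\<close> and \<open>psi_2\<close> below holds.
\<close>

definition ls_represents ::
  "real \<Rightarrow> real \<Rightarrow> real \<Rightarrow> real \<Rightarrow> (real \<times> real \<Rightarrow> real) \<Rightarrow>
   (real \<times> real) measure \<Rightarrow> (real \<times> real) measure \<Rightarrow> bool" where
  "ls_represents xl xu yl yu \<psi> M N \<longleftrightarrow>
     finite_measure M \<and> finite_measure N \<and> sets M = sets borel \<and> sets N = sets borel \<and>
     emeasure M (- ({xl<..xu} \<times> {yl<..yu})) = 0 \<and>
     emeasure N (- ({xl<..xu} \<times> {yl<..yu})) = 0 \<and>
     (\<forall>x0 x1 y0 y1. xl \<le> x0 \<and> x0 \<le> x1 \<and> x1 \<le> xu \<and> yl \<le> y0 \<and> y0 \<le> y1 \<and> y1 \<le> yu \<longrightarrow>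
        rect_incr \<psi> x0 x1 y0 y1 =
          measure M ({x0<..x1} \<times> {y0<..y1}) - measure N ({x0<..x1} \<times> {y0<..y1}))"

definition ls_integrator ::
  "real \<Rightarrow> real \<Rightarrow> real \<Rightarrow> real \<Rightarrow> (real \<times> real \<Rightarrow> real) \<Rightarrow> bool" where
  "ls_integrator xl xu yl yu \<psi> \<longleftrightarrow> (\<exists>M N. ls_represents xl xu yl yu \<psi> M N)"

text \<open>The value does not depend on the representing pair, by uniqueness of \<open>d\<psi>\<close>.\<close>

definition ls_integral ::
  "real \<Rightarrow> real \<Rightarrow> real \<Rightarrow> real \<Rightarrow> (real \<times> real \<Rightarrow> real) \<Rightarrow> (real \<times> real \<Rightarrow> real) \<Rightarrow> real" where
  "ls_integral xl xu yl yu u \<psi> =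
     (THE I. \<exists>M N. ls_represents xl xu yl yu \<psi> M N \<and>
        set_integrable M ({xl..xu} \<times> {yl..yu}) u \<and> set_integrable N ({xl..xu} \<times> {yl..yu}) u \<and>
        I = (LINT p:{xl..xu} \<times> {yl..yu}|M. u p) - (LINT p:{xl..xu} \<times> {yl..yu}|N. u p))"

definition psi_hat :: "real \<Rightarrow> real \<Rightarrow> (real \<times> real \<Rightarrow> real) \<Rightarrow> real \<Rightarrow> real \<Rightarrow> real" where
  "psi_hat xu yu \<psi> x y = \<psi> (xu, yu) - \<psi> (x, yu) - \<psi> (xu, y) + \<psi> (x, y)"

definition psi_1 :: "real \<Rightarrow> real \<Rightarrow> real \<Rightarrow> (real \<times> real \<Rightarrow> real) \<Rightarrow> real \<Rightarrow> real" where
  "psi_1 xu yl yu \<psi> x = \<psi> (xu, yu) - \<psi> (x, yu) - \<psi> (xu, yl) + \<psi> (x, yl)"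

definition psi_2 :: "real \<Rightarrow> real \<Rightarrow> real \<Rightarrow> (real \<times> real \<Rightarrow> real) \<Rightarrow> real \<Rightarrow> real" where
  "psi_2 xl xu yu \<psi> y = \<psi> (xu, yu) - \<psi> (xl, yu) - \<psi> (xu, y) + \<psi> (xl, y)"


section \<open>Utility functions\<close>

text \<open>
  Functions on \<open>T = {xl..xu} \<times> {yl..yu}\<close> are extensional (\<open>undefined\<close> outside \<open>T\<close>).
  Concavity of \<open>u(\<cdot>, b)\<close> is required for \<open>b \<in> B\<close> and concavity of \<open>u(a, \<cdot>)\<close> for \<open>a \<in> A\<close>; with
  \<open>A = {xl..xu}\<close> and \<open>B = {yl..yu}\<close> the functions are concave in each single variable for
  \<^emph>\<open>every\<close> fixed value of the other variable.

  For Type-1 piecewise linear functions the two requirements differ: on a cell with relative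
  coordinates \<open>s, t\<close> such a function is an affine function plus \<open>D * min s t\<close>, where
  \<open>D = v (i+1, j+1) - v (i, j+1) - v (i+1, j) + v (i, j)\<close>.  It is conservative iff \<open>D \<le> 0\<close>, but
  concave in \<open>s\<close> for fixed \<open>t\<close> strictly between 0 and 1 iff \<open>D \<ge> 0\<close>.  Concavity for every value
  thus forces \<open>D = 0\<close>, whereas concavity on the grid lines only compares grid values.
\<close>

definition utility_class ::
  "real \<Rightarrow> real \<Rightarrow> real \<Rightarrow> real \<Rightarrow> real \<Rightarrow> real set \<Rightarrow> real set \<Rightarrow> (real \<times> real \<Rightarrow> real) set" where
  "utility_class xl xu yl yu L A B =
     {u \<in> ({xl..xu} \<times> {yl..yu}) \<rightarrow>\<^sub>E {0..1}.
        continuous_on ({xl..xu} \<times> {yl..yu}) u \<and>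
        (\<forall>y\<in>{yl..yu}. mono_on {xl..xu} (\<lambda>x. u (x, y))) \<and>
        (\<forall>x\<in>{xl..xu}. mono_on {yl..yu} (\<lambda>y. u (x, y))) \<and>
        u (xl, yl) = 0 \<and> u (xu, yu) = 1 \<and>
        (\<forall>x0\<in>{xl..xu}. \<forall>x1\<in>{xl..xu}. \<forall>y0\<in>{yl..yu}. \<forall>y1\<in>{yl..yu}. x0 < x1 \<and> y0 < y1 \<longrightarrow>
           u (x0, y1) + u (x1, y0) \<ge> u (x0, y0) + u (x1, y1)) \<and>
        (\<forall>b\<in>B. concave_on {xl..xu} (\<lambda>x. u (x, b))) \<and>
        (\<forall>a\<in>A. concave_on {yl..yu} (\<lambda>y. u (a, y))) \<and>
        (\<forall>x\<in>{xl..xu}. \<forall>x'\<in>{xl..xu}. \<forall>y\<in>{yl..yu}. \<forall>y'\<in>{yl..yu}.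
           \<bar>u (x, y) - u (x', y')\<bar> \<le> L * (\<bar>x - x'\<bar> + \<bar>y - y'\<bar>))}"


section \<open>Grids and Type-1 piecewise linear functions\<close>

definition is_grid :: "real \<Rightarrow> real \<Rightarrow> nat \<Rightarrow> (nat \<Rightarrow> real) \<Rightarrow> bool" where
  "is_grid a b N xs \<longleftrightarrow> 2 \<le> N \<and> strict_mono_on {1..N} xs \<and> xs 1 = a \<and> xs N = b"

definition cell_side :: "(nat \<Rightarrow> real) \<Rightarrow> nat \<Rightarrow> real set" where
  "cell_side xs i = (if i = 1 then {xs 1..xs 2} else {xs i<..xs (i+1)})"

definition cell :: "(nat \<Rightarrow> real) \<Rightarrow> (nat \<Rightarrow> real) \<Rightarrow> nat \<Rightarrow> nat \<Rightarrow> (real \<times> real) set" where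
  "cell xs ys i j = cell_side xs i \<times> cell_side ys j"

definition Delta_l :: "(nat \<Rightarrow> real) \<Rightarrow> (nat \<Rightarrow> real) \<Rightarrow> nat \<Rightarrow> nat \<Rightarrow> (real \<times> real) set" where
  "Delta_l xs ys i j =
     {(x, y). (y - ys j) * (xs (i+1) - xs i) \<le> (ys (j+1) - ys j) * (x - xs i)}"

definition Delta_u :: "(nat \<Rightarrow> real) \<Rightarrow> (nat \<Rightarrow> real) \<Rightarrow> nat \<Rightarrow> nat \<Rightarrow> (real \<times> real) set" where
  "Delta_u xs ys i j = UNIV - Delta_l xs ys i j"

definition u_1u ::
  "(nat \<Rightarrow> real) \<Rightarrow> (nat \<Rightarrow> real) \<Rightarrow> (nat \<times> nat \<Rightarrow> real) \<Rightarrow> nat \<Rightarrow> nat \<Rightarrow> real \<times> real \<Rightarrow> real" where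
  "u_1u xs ys v i j = (\<lambda>(x, y).
      (ys (j+1) - y) / (ys (j+1) - ys j) * v (i, j)
    + ((y - ys j) / (ys (j+1) - ys j) - (x - xs i) / (xs (i+1) - xs i)) * v (i, j+1)
    + (x - xs i) / (xs (i+1) - xs i) * v (i+1, j+1))"

definition u_1l ::
  "(nat \<Rightarrow> real) \<Rightarrow> (nat \<Rightarrow> real) \<Rightarrow> (nat \<times> nat \<Rightarrow> real) \<Rightarrow> nat \<Rightarrow> nat \<Rightarrow> real \<times> real \<Rightarrow> real" where
  "u_1l xs ys v i j = (\<lambda>(x, y).
      (xs (i+1) - x) / (xs (i+1) - xs i) * v (i, j)
    + ((x - xs i) / (xs (i+1) - xs i) - (y - ys j) / (ys (j+1) - ys j)) * v (i+1, j)
    + (y - ys j) / (ys (j+1) - ys j) * v (i+1, j+1))"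

definition type1_pl ::
  "nat \<Rightarrow> nat \<Rightarrow> (nat \<Rightarrow> real) \<Rightarrow> (nat \<Rightarrow> real) \<Rightarrow> (real \<times> real \<Rightarrow> real) \<Rightarrow> bool" where
  "type1_pl N1 N2 xs ys u \<longleftrightarrow>
     (\<exists>v. \<forall>i\<in>{1..N1-1}. \<forall>j\<in>{1..N2-1}.
        (\<forall>q \<in> cell xs ys i j \<inter> Delta_u xs ys i j. u q = u_1u xs ys v i j q) \<and>
        (\<forall>q \<in> cell xs ys i j \<inter> Delta_l xs ys i j. u q = u_1l xs ys v i j q))"

definition grid_values ::
  "nat \<Rightarrow> nat \<Rightarrow> (nat \<Rightarrow> real) \<Rightarrow> (nat \<Rightarrow> real) \<Rightarrow> (real \<times> real \<Rightarrow> real) \<Rightarrow> (nat \<times> nat \<Rightarrow> real)" where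
  "grid_values N1 N2 xs ys u = (\<lambda>(i, j)\<in>{1..N1} \<times> {1..N2}. u (xs i, ys j))"

definition ambiguity_set ::
  "(nat \<Rightarrow> real) \<Rightarrow> (nat \<Rightarrow> real) \<Rightarrow> nat \<Rightarrow> nat \<Rightarrow> real \<Rightarrow> real set \<Rightarrow> real set \<Rightarrow>
   nat \<Rightarrow> (nat \<Rightarrow> real \<times> real \<Rightarrow> real) \<Rightarrow> (nat \<Rightarrow> real) \<Rightarrow> (real \<times> real \<Rightarrow> real) set" where
  "ambiguity_set xs ys N1 N2 L A B M \<psi> c =
     {u \<in> utility_class (xs 1) (xs N1) (ys 1) (ys N2) L A B.
        type1_pl N1 N2 xs ys u \<and>
        (\<forall>l\<in>{1..M}. ls_integral (xs 1) (xs N1) (ys 1) (ys N2) u (\<psi> l) \<le> c l)}"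


section \<open>The linear program\<close>

definition diag :: "(nat \<Rightarrow> real) \<Rightarrow> (nat \<Rightarrow> real) \<Rightarrow> nat \<Rightarrow> nat \<Rightarrow> real \<Rightarrow> real" where
  "diag xs ys i j x = ys j + (ys (j+1) - ys j) / (xs (i+1) - xs i) * (x - xs i)"

definition lp_feasible ::
  "(nat \<Rightarrow> real) \<Rightarrow> (nat \<Rightarrow> real) \<Rightarrow> nat \<Rightarrow> nat \<Rightarrow> real \<Rightarrow>
   nat \<Rightarrow> (nat \<Rightarrow> real \<times> real \<Rightarrow> real) \<Rightarrow> (nat \<Rightarrow> real) \<Rightarrow> (nat \<times> nat \<Rightarrow> real) set" where
  "lp_feasible xs ys N1 N2 L M \<psi> c =
     {v \<in> ({1..N1} \<times> {1..N2}) \<rightarrow>\<^sub>E UNIV.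
        (\<forall>l\<in>{1..M}.
            (\<Sum>i=1..N1-1. \<Sum>j=1..N2-1.
               (v (i+1, j+1) - v (i, j+1) - v (i+1, j) + v (i, j)) / (xs (i+1) - xs i) *
               (LBINT x:{xs i..xs (i+1)}. psi_hat (xs N1) (ys N2) (\<psi> l) x (diag xs ys i j x)))
          + (\<Sum>i=1..N1-1. (v (i+1, 1) - v (i, 1)) / (xs (i+1) - xs i) *
               (LBINT x:{xs i..xs (i+1)}. psi_1 (xs N1) (ys 1) (ys N2) (\<psi> l) x))
          + (\<Sum>j=1..N2-1. (v (1, j+1) - v (1, j)) / (ys (j+1) - ys j) *
               (LBINT y:{ys j..ys (j+1)}. psi_2 (xs 1) (xs N1) (ys N2) (\<psi> l) y))
          \<le> c l) \<and>
        (\<forall>i\<in>{2..N1-1}. \<forall>j\<in>{1..N2}.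
            (v (i+1, j) - v (i, j)) / (xs (i+1) - xs i)
              \<le> (v (i, j) - v (i-1, j)) / (xs i - xs (i-1))) \<and>
        (\<forall>i\<in>{1..N1}. \<forall>j\<in>{2..N2-1}.
            (v (i, j+1) - v (i, j)) / (ys (j+1) - ys j)
              \<le> (v (i, j) - v (i, j-1)) / (ys j - ys (j-1))) \<and>
        (\<forall>i\<in>{1..N1-1}. \<forall>j\<in>{1..N2}. v (i+1, j) - v (i, j) \<le> L * (xs (i+1) - xs i)) \<and>
        (\<forall>i\<in>{1..N1}. \<forall>j\<in>{1..N2-1}. v (i, j+1) - v (i, j) \<le> L * (ys (j+1) - ys j)) \<and>
        (\<forall>i\<in>{1..N1-1}. \<forall>j\<in>{1..N2}. v (i+1, j) \<ge> v (i, j)) \<and>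
        (\<forall>i\<in>{1..N1}. \<forall>j\<in>{1..N2-1}. v (i, j+1) \<ge> v (i, j)) \<and>
        (\<forall>i\<in>{1..N1-1}. \<forall>j\<in>{1..N2-1}. v (i, j) + v (i+1, j+1) \<le> v (i, j+1) + v (i+1, j)) \<and>
        v (1, 1) = 0 \<and> v (N1, N2) = 1}"

definition lp_objective ::
  "(nat \<Rightarrow> real) \<Rightarrow> (nat \<Rightarrow> real) \<Rightarrow> nat \<Rightarrow> nat \<Rightarrow> nat \<Rightarrow> (nat \<Rightarrow> real) \<Rightarrow> (nat \<Rightarrow> real \<times> real) \<Rightarrow>
   (nat \<times> nat \<Rightarrow> real) \<Rightarrow> real" where
  "lp_objective xs ys N1 N2 K p fk v =
     (\<Sum>k=1..K. p k * (\<Sum>i=1..N1-1. \<Sum>j=1..N2-1.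
        indicat_real (cell xs ys i j) (fk k) *
          (u_1l xs ys v i j (fk k) * indicat_real (Delta_l xs ys i j) (fk k)
         + u_1u xs ys v i j (fk k) * indicat_real (Delta_u xs ys i j) (fk k))))"

text \<open>
  Minimising \<open>g\<close> over \<open>S\<close> is reformulated, via the change of variables \<open>\<phi>\<close>, as minimising \<open>h\<close>
  over \<open>R\<close>: feasible points correspond one-to-one with equal objective values, and the
  minimisers and the optimal values (\<open>\<infinity>\<close> if infeasible) of the two problems agree.
\<close>

definition reformulates ::
  "('a \<Rightarrow> 'b) \<Rightarrow> 'a set \<Rightarrow> ('a \<Rightarrow> real) \<Rightarrow> 'b set \<Rightarrow> ('b \<Rightarrow> real) \<Rightarrow> bool" where
  "reformulates \<phi> S g R h \<longleftrightarrow>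
     bij_betw \<phi> S R \<and>
     (\<forall>u\<in>S. h (\<phi> u) = g u) \<and>
     (\<forall>u\<in>S. is_arg_min g (\<lambda>w. w \<in> S) u \<longleftrightarrow> is_arg_min h (\<lambda>w. w \<in> R) (\<phi> u)) \<and>
     (INF u\<in>S. ereal (g u)) = (INF v\<in>R. ereal (h v))"

end

theory Submission
  imports Defs
begin

text \<open>
  On a cell with relative coordinates \<open>s, t \<in> [0, 1]\<close> a Type-1 function is an affine function plus
  \<open>D * min s t\<close>, where \<open>D\<close> is the mixed second difference of the four corner values.  Globally, if
  \<open>S\<^sub>i\<close> denotes the ramp that climbs from 0 to 1 across the \<open>i\<close>-th interval of a grid
  and \<open>T\<^sub>j\<close> the analogous ramp in the second variable, the Type-1 function with grid values \<open>v\<close> is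
  \<open>v (1, 1) + (\<Sum>i. a\<^sub>i * S\<^sub>i x) + (\<Sum>j. b\<^sub>j * T\<^sub>j y) + (\<Sum>i j. D\<^sub>i\<^sub>j * min (S\<^sub>i x) (T\<^sub>j y))\<close>,
  where \<open>a\<^sub>i\<close> and \<open>b\<^sub>j\<close> are the increments of \<open>v\<close> along the lower and the left edge.  This is
  \<open>pl_interp\<close>; \<open>type1_pl_iff_pl_interp\<close> says that it describes exactly the Type-1 functions.
  In this form all properties can be read off from the coefficients.

  The shape constraints: \<open>min\<close> is supermodular, so \<open>D\<^sub>i\<^sub>j \<le> 0\<close> makes the function conservative.
  Conservativity moves increments between horizontal lines: an increment in \<open>x\<close> is smallest on the
  upper edge and largest on the lower edge.  On these edges the function is a one-dimensional
  interpolation, hence monotonicity comes from the upper edge and the Lipschitz bound from the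
  lower edge (\<open>pl_interp_increment_bounds\<close>).  The function is also a one-dimensional interpolation
  on every other grid line, and such an interpolation is concave if its slopes decrease
  (\<open>concave_sum_ramp\<close>).  Away from the grid lines \<open>D\<^sub>i\<^sub>j < 0\<close> produces a convex kink at the diagonal;
  concavity for every value of the other variable thus means that all \<open>D\<^sub>i\<^sub>j\<close> vanish, and then all
  horizontal sections agree up to constants.

  The budget constraints: \<open>S\<^sub>i\<close>, \<open>T\<^sub>j\<close> and \<open>min (S\<^sub>i x) (T\<^sub>j y)\<close> are normalized lengths of
  \<open>{s. \<gamma> s < (x, y)}\<close>, where the curve \<open>\<gamma>\<close> runs along a piece of the lower edge, of the left edge,
  or along the diagonal of a cell.  Fubini's theorem turns the integral of such a length against
  \<open>d\<psi>\<close> into the integral along \<open>\<gamma>\<close> of the \<open>d\<psi>\<close>-mass of the rectangle to the upper right of \<open>\<gamma> s\<close>,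
  that is, of \<open>psi_1\<close>, \<open>psi_2\<close> or \<open>psi_hat\<close> (\<open>ls_integral_pl_interp\<close>).  The result involves only
  \<open>\<psi>\<close> and not the measures that represent \<open>d\<psi>\<close>, which also makes the Lebesgue--Stieltjes integral
  well-defined for these integrands.

  Consequently taking grid values and interpolating are mutually inverse bijections between the
  ambiguity set and the feasible set of the linear program, restricted to \<open>D\<^sub>i\<^sub>j = 0\<close> if concavity
  is required on all lines, and they preserve the objective.
\<close>

section \<open>Interpolation on a one-dimensional grid\<close>

lemma is_grid_less:
  assumes "is_grid a b N xs" and "1 \<le> i" "i < j" "j \<le> N"
  shows "xs i < xs j"
  using assms unfolding is_grid_def strict_mono_on_def by auto

lemma is_grid_mono:
  assumes "is_grid a b N xs" and "1 \<le> i" "i \<le> j" "j \<le> N"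
  shows "xs i \<le> xs j"
  using is_grid_less[of a b N xs i j] assms by (cases "i = j") auto

lemma is_grid_step:
  assumes "is_grid a b N xs" and "i \<in> {1..N-1}"
  shows "xs i < xs (i+1)"
proof -
  have "i + 1 \<le> N" using assms(2) by auto
  with assms show ?thesis by (intro is_grid_less[OF assms(1)]) auto
qed

lemma is_grid_in_interval:
  assumes "is_grid a b N xs" and "i \<in> {1..N}"
  shows "xs i \<in> {a..b}"
  using is_grid_mono[OF assms(1), of 1 i] is_grid_mono[OF assms(1), of i N] assms
  by (auto simp: is_grid_def)

lemma cell_side_unique:
  assumes "is_grid a b N xs" and "i \<in> {1..N-1}" and "x \<in> cell_side xs i"
    and "k \<in> {1..N-1}" and "x \<in> cell_side xs k"
  shows "k = i"
proof -
  have False if "m < n" "m \<in> {1..N-1}" "n \<in> {1..N-1}" "x \<in> cell_side xs m" "x \<in> cell_side xs n"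
    for m n
  proof -
    have "x \<le> xs (m+1)" "xs n < x"
      using that by (auto simp: cell_side_def numeral_2_eq_2 split: if_splits)
    moreover have "xs (m+1) \<le> xs n"
      by (rule is_grid_mono[OF assms(1)]) (use that in auto)
    ultimately show False by simp
  qed
  then show ?thesis
    using assms by (metis linorder_neqE_nat)
qed

lemma cell_side_exists:
  assumes grid: "is_grid a b N xs" and x: "x \<in> {a..b}"
  obtains i where "i \<in> {1..N-1}" "x \<in> cell_side xs i"
proof -
  define i where "i = (LEAST k. 1 \<le> k \<and> x \<le> xs (k+1))"
  \<comment> \<open>The last index is a candidate, since the grid ends at \<open>b\<close>.\<close>
  have N: "1 \<le> N - 1 \<and> x \<le> xs (N - 1 + 1)"
    using grid x by (auto simp: is_grid_def)
  have i: "1 \<le> i" "x \<le> xs (i+1)"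
    using LeastI[of "\<lambda>k. 1 \<le> k \<and> x \<le> xs (k+1)", OF N] by (auto simp: i_def)
  have "i \<le> N - 1"
    unfolding i_def by (rule Least_le) (use N in auto)
  moreover have "xs i < x" if "i \<noteq> 1"
  proof (rule ccontr)
    assume "\<not> xs i < x"
    then have "i \<le> i - 1"
      using i that
      by (subst i_def, intro Least_le) auto
    with i that show False by auto
  qed
  ultimately show thesis
    using i x grid by (intro that[of i]) (auto simp: cell_side_def is_grid_def numeral_2_eq_2)
qed

text \<open>
  The ramps are the building blocks of piecewise linear functions: interpolating values \<open>g\<close> on the
  grid amounts to adding the increments of \<open>g\<close>, each multiplied by the ramp of its interval.
\<close>

definition ramp :: "(nat \<Rightarrow> real) \<Rightarrow> nat \<Rightarrow> real \<Rightarrow> real" where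
  "ramp xs i x = max 0 (min 1 ((x - xs i) / (xs (i+1) - xs i)))"

lemma ramp_bounds: "0 \<le> ramp xs i x" "ramp xs i x \<le> 1"
  by (auto simp: ramp_def)

lemma ramp_mono:
  assumes "xs i < xs (i+1)" and "x \<le> x'"
  shows "ramp xs i x \<le> ramp xs i x'"
proof -
  have "(x - xs i) / (xs (i+1) - xs i) \<le> (x' - xs i) / (xs (i+1) - xs i)"
    using assms by (intro divide_right_mono) auto
  then show ?thesis by (auto simp: ramp_def)
qed

lemma ramp_eq_0: "xs i < xs (i+1) \<Longrightarrow> x \<le> xs i \<Longrightarrow> ramp xs i x = 0"
  by (auto simp: ramp_def max_def min_def divide_simps)

lemma ramp_eq_1: "xs i < xs (i+1) \<Longrightarrow> xs (i+1) \<le> x \<Longrightarrow> ramp xs i x = 1"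
  by (auto simp: ramp_def max_def min_def divide_simps)

lemma ramp_between:
  "xs i < xs (i+1) \<Longrightarrow> xs i \<le> x \<Longrightarrow> x \<le> xs (i+1) \<Longrightarrow>
    ramp xs i x = (x - xs i) / (xs (i+1) - xs i)"
  by (auto simp: ramp_def max_def min_def divide_simps)

lemma continuous_on_ramp [continuous_intros]:
  "continuous_on S g \<Longrightarrow> continuous_on S (\<lambda>q. ramp xs i (g q))"
  unfolding ramp_def divide_inverse by (intro continuous_intros)

lemma ramp_in_cell:
  assumes "is_grid a b N xs" and "i \<in> {1..N-1}" and "x \<in> cell_side xs i"
  shows "ramp xs i x = (x - xs i) / (xs (i+1) - xs i)"
  using assms is_grid_step[OF assms(1), of i]
  by (intro ramp_between) (auto simp: cell_side_def numeral_2_eq_2 split: if_splits)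

lemma ramp_off_cell:
  assumes "is_grid a b N xs" and "i \<in> {1..N-1}" and "x \<in> cell_side xs i" and "k \<in> {1..N-1}" "k \<noteq> i"
  shows "ramp xs k x = of_bool (k < i)"
proof -
  have x: "xs i \<le> x" "x \<le> xs (i+1)"
    using assms(3) by (auto simp: cell_side_def numeral_2_eq_2 split: if_splits)
  have k: "xs k < xs (k+1)"
    using is_grid_step[OF assms(1)] assms by auto
  show ?thesis
  proof (cases "k < i")
    case True
    have "xs (k+1) \<le> xs i"
      by (rule is_grid_mono[OF assms(1)]) (use True assms in auto)
    with True k x show ?thesis by (simp add: ramp_eq_1)
  next
    case False
    have "xs (i+1) \<le> xs k"
      by (rule is_grid_mono[OF assms(1)]) (use False assms in auto)
    with False k x show ?thesis by (simp add: ramp_eq_0)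
  qed
qed

lemma ramp_at_gridpoint:
  assumes "is_grid a b N xs" and "m \<in> {1..N}" and "k \<in> {1..N-1}"
  shows "ramp xs k (xs m) = of_bool (k < m)"
proof (cases "k < m")
  case True
  have "xs (k+1) \<le> xs m"
    by (rule is_grid_mono[OF assms(1)]) (use True assms in auto)
  with True show ?thesis
    using is_grid_step[OF assms(1,3)] by (simp add: ramp_eq_1)
next
  case False
  have "xs m \<le> xs k"
    by (rule is_grid_mono[OF assms(1)]) (use False assms in auto)
  with False show ?thesis
    using is_grid_step[OF assms(1,3)] by (simp add: ramp_eq_0)
qed

lemma sum_increments_below:
  fixes g :: "nat \<Rightarrow> real"
  assumes "1 \<le> m" "m \<le> n + 1"
  shows "(\<Sum>k=1..n. (g (k+1) - g k) * of_bool (k < m)) = g m - g 1"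
proof -
  have "(\<Sum>k=1..n. (g (k+1) - g k) * of_bool (k < m)) = (\<Sum>k=1..<m. g (Suc k) - g k)"
    by (rule sum.mono_neutral_cong_right) (use assms in auto)
  also have "\<dots> = g m - g 1"
    using assms by (subst sum_Suc_diff') auto
  finally show ?thesis .
qed

lemma sum_ramp_at_gridpoint:
  fixes g :: "nat \<Rightarrow> real"
  assumes "is_grid a b N xs" and "m \<in> {1..N}"
  shows "(\<Sum>k=1..N-1. (g (k+1) - g k) * ramp xs k (xs m)) = g m - g 1"
proof -
  have "(\<Sum>k=1..N-1. (g (k+1) - g k) * ramp xs k (xs m)) =
      (\<Sum>k=1..N-1. (g (k+1) - g k) * of_bool (k < m))"
    using ramp_at_gridpoint[OF assms] by (intro sum.cong) auto
  also have "\<dots> = g m - g 1"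
    using assms by (intro sum_increments_below) auto
  finally show ?thesis .
qed

text \<open>
  The sum telescopes: ramps to the left of \<open>x\<close> are 1, ramps to the right are 0, and only the ramp of
  the interval containing \<open>x\<close> is active.
\<close>

lemma sum_ramp_in_cell:
  fixes g :: "nat \<Rightarrow> real"
  assumes "is_grid a b N xs" and i: "i \<in> {1..N-1}" and "x \<in> cell_side xs i"
  shows "(\<Sum>k=1..N-1. (g (k+1) - g k) * ramp xs k x) = g i - g 1 + (g (i+1) - g i) * ramp xs i x"
proof -
  have "(\<Sum>k=1..N-1. (g (k+1) - g k) * ramp xs k x) =
      (\<Sum>k=1..N-1. (g (k+1) - g k) * of_bool (k < i) +
        (if k = i then (g (i+1) - g i) * ramp xs i x else 0))"
    using ramp_off_cell[OF assms] by (intro sum.cong) auto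
  also have "\<dots> = (\<Sum>k=1..N-1. (g (k+1) - g k) * of_bool (k < i)) + (g (i+1) - g i) * ramp xs i x"
    using i by (simp add: sum.distrib)
  also have "(\<Sum>k=1..N-1. (g (k+1) - g k) * of_bool (k < i)) = g i - g 1"
    using i by (intro sum_increments_below) auto
  finally show ?thesis .
qed

lemma sum_width_ramp:
  assumes "is_grid a b N xs" and "x \<in> {a..b}"
  shows "(\<Sum>k=1..N-1. (xs (k+1) - xs k) * ramp xs k x) = x - a"
proof -
  obtain i where i: "i \<in> {1..N-1}" "x \<in> cell_side xs i"
    using cell_side_exists[OF assms] .
  have "xs i < xs (i+1)"
    using is_grid_step[OF assms(1)] i by auto
  then have "(xs (i+1) - xs i) * ramp xs i x = x - xs i"
    by (simp add: ramp_in_cell[OF assms(1) i])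
  then show ?thesis
    using sum_ramp_in_cell[OF assms(1) i, of xs] assms(1) by (simp add: is_grid_def)
qed

lemma concave_on_cong_ivl:
  fixes g :: "real \<Rightarrow> real"
  assumes "concave_on {a..b} g" and "\<And>x. x \<in> {a..b} \<Longrightarrow> h x = g x"
  shows "concave_on {a..b} h"
  using assms unfolding concave_on_iff by (smt (verit, best) convexD)

lemma concave_on_min_const:
  fixes d :: real
  assumes "convex S"
  shows "concave_on S (\<lambda>x. min x d)"
  unfolding concave_on_iff
proof (intro conjI ballI allI impI assms)
  fix x y u v :: real
  assume "0 \<le> u" "0 \<le> v" "u + v = 1"
  then have "u * min x d + v * min y d \<le> u * x + v * y"
      "u * min x d + v * min y d \<le> u * d + v * d"
    by (intro add_mono mult_left_mono; simp)+
  moreover have "u * d + v * d = d"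
    using \<open>u + v = 1\<close> by (simp flip: distrib_right)
  ultimately show "u * min x d + v * min y d \<le> min (u *\<^sub>R x + v *\<^sub>R y) d"
    by simp
qed

text \<open>
  The ramp of the \<open>k\<close>-th interval, scaled by its width, is \<open>min x (xs (k+1)) - min x (xs k)\<close>.
  Summation by parts writes the interpolation as a combination of the concave functions
  \<open>min x (xs k)\<close> whose inner coefficients are the drops of the slopes, hence nonnegative; the two
  boundary terms are affine on \<open>{a..b}\<close>.
\<close>

lemma concave_sum_ramp:
  fixes g :: "nat \<Rightarrow> real"
  assumes grid: "is_grid a b N xs"
    and slopes: "\<And>i. i \<in> {2..N-1} \<Longrightarrow>
      (g (i+1) - g i) / (xs (i+1) - xs i) \<le> (g i - g (i-1)) / (xs i - xs (i-1))"
  shows "concave_on {a..b} (\<lambda>x. \<Sum>k=1..N-1. (g (k+1) - g k) * ramp xs k x)"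
proof -
  define m where "m k = (g (k+1) - g k) / (xs (k+1) - xs k)" for k
  define G where "G n x = (\<Sum>k=1..n. (g (k+1) - g k) * ramp xs k x)" for n x
  have term_eq: "(g (k+1) - g k) * ramp xs k x = m k * (min x (xs (k+1)) - min x (xs k))"
    if "k \<in> {1..N-1}" for k x
  proof -
    have "xs k < xs (k+1)" using is_grid_step[OF grid] that by auto
    then have "(xs (k+1) - xs k) * ramp xs k x = min x (xs (k+1)) - min x (xs k)"
      by (cases "x \<le> xs k"; cases "xs (k+1) \<le> x") (simp_all add: ramp_eq_0 ramp_eq_1 ramp_between)
    from this[symmetric] show ?thesis
      using \<open>xs k < xs (k+1)\<close> by (simp add: m_def)
  qed
  \<comment> \<open>The subtracted term is the upper boundary term of the summation by parts; the next step trades it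
    for \<open>(m n - m (n+1)) * min x (xs (n+1))\<close>.\<close>
  have "concave_on {a..b} (\<lambda>x. G n x - m n * min x (xs (n+1)))" if "1 \<le> n" "n \<le> N - 1" for n
    using that
  proof (induction n rule: dec_induct)
    case base
    have "G 1 x - m 1 * min x (xs (1+1)) = - m 1 * a" if "x \<in> {a..b}" for x
    proof -
      have "min x (xs 1) = a" using that grid by (auto simp: is_grid_def)
      then show ?thesis
        using term_eq[of 1 x] base that by (simp add: G_def algebra_simps)
    qed
    moreover have "concave_on {a..b} (\<lambda>x. - m 1 * a)"
      by (simp add: concave_on_const)
    ultimately show ?case by (rule concave_on_cong_ivl[rotated])
  next
    case (step n)
    have "m (n+1) \<le> m n"
      using slopes[of "n+1"] step by (simp add: m_def)
    then have "concave_on {a..b} (\<lambda>x. (G n x - m n * min x (xs (n+1))) +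
        (m n - m (n+1)) * min x (xs (n+1)))"
      using step by (intro concave_on_add concave_on_cmul concave_on_min_const) auto
    moreover have "G (Suc n) x - m (Suc n) * min x (xs (Suc n+1)) =
        (G n x - m n * min x (xs (n+1))) + (m n - m (n+1)) * min x (xs (n+1))" for x
      using term_eq[of "n+1" x] step by (simp add: G_def algebra_simps)
    ultimately show ?case by simp
  qed
  from this[of "N-1"] have conc: "concave_on {a..b} (\<lambda>x. G (N-1) x - m (N-1) * min x (xs N))"
    using grid by (auto simp: is_grid_def)
  have "concave_on {a..b} (\<lambda>x. m (N-1) * x)"
    by (simp add: concave_on_iff algebra_simps)
  from concave_on_add[OF conc this] have *: "concave_on {a..b} (\<lambda>x. G (N-1) x - m (N-1) * min x (xs N) + m (N-1) * x)" .
  have "concave_on {a..b} (G (N-1))"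
    by (rule concave_on_cong_ivl[OF *]) (use grid in \<open>auto simp: is_grid_def\<close>)
  then show ?thesis by (simp add: G_def[abs_def])
qed

section \<open>Type-1 functions as combinations of ramps and their minima\<close>

definition mixed_diff :: "(nat \<times> nat \<Rightarrow> real) \<Rightarrow> nat \<Rightarrow> nat \<Rightarrow> real" where
  "mixed_diff v i j = v (i+1, j+1) - v (i, j+1) - v (i+1, j) + v (i, j)"

definition pl_interp ::
  "nat \<Rightarrow> nat \<Rightarrow> (nat \<Rightarrow> real) \<Rightarrow> (nat \<Rightarrow> real) \<Rightarrow> (nat \<times> nat \<Rightarrow> real) \<Rightarrow> real \<times> real \<Rightarrow> real" where
  "pl_interp N1 N2 xs ys v = (\<lambda>(x, y). v (1, 1)
     + (\<Sum>i=1..N1-1. (v (i+1, 1) - v (i, 1)) * ramp xs i x)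
     + (\<Sum>j=1..N2-1. (v (1, j+1) - v (1, j)) * ramp ys j y)
     + (\<Sum>i=1..N1-1. \<Sum>j=1..N2-1. mixed_diff v i j * min (ramp xs i x) (ramp ys j y)))"

text \<open>
  Exchanging the two coordinates transfers each statement about the first variable to the second.
\<close>

lemma pl_interp_swap:
  "pl_interp N1 N2 xs ys v (x, y) = pl_interp N2 N1 ys xs (\<lambda>(j, i). v (i, j)) (y, x)"
  unfolding pl_interp_def mixed_diff_def prod.case
  by (subst sum.swap) (simp add: min.commute algebra_simps)

lemma continuous_on_pl_interp: "continuous_on S (pl_interp N1 N2 xs ys v)"
  unfolding pl_interp_def case_prod_beta by (intro continuous_intros)

text \<open>
  If \<open>k \<noteq> i\<close> or \<open>l \<noteq> j\<close>, one of the two ramps in \<open>min (S\<^sub>k x) (T\<^sub>l y)\<close> is 0 or 1, so the minimum is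
  the product.  Up to a correction in a single summand the double sum is therefore bilinear, and it
  telescopes in each variable separately.
\<close>

lemma pl_interp_in_cell:
  assumes gx: "is_grid xl xu N1 xs" and gy: "is_grid yl yu N2 ys"
    and i: "i \<in> {1..N1-1}" and j: "j \<in> {1..N2-1}"
    and xy: "(x, y) \<in> cell xs ys i j"
  shows "pl_interp N1 N2 xs ys v (x, y) = v (i, j)
      + (v (i+1, j) - v (i, j)) * ramp xs i x + (v (i, j+1) - v (i, j)) * ramp ys j y
      + mixed_diff v i j * min (ramp xs i x) (ramp ys j y)"
proof -
  define s where "s k = ramp xs k x" for k
  define t where "t l = ramp ys l y" for l
  have x: "x \<in> cell_side xs i" and y: "y \<in> cell_side ys j"
    using xy by (auto simp: cell_def)
  note sum_s = sum_ramp_in_cell[OF gx i x, folded s_def]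
  note sum_t = sum_ramp_in_cell[OF gy j y, folded t_def]
  define e where "e = min (s i) (t j) - s i * t j"
  have min_st: "min (s k) (t l) = s k * t l + (if k = i \<and> l = j then e else 0)"
    if "k \<in> {1..N1-1}" "l \<in> {1..N2-1}" for k l
    using ramp_off_cell[OF gx i x that(1)] ramp_off_cell[OF gy j y that(2)]
      ramp_bounds[of xs k x] ramp_bounds[of ys l y]
    by (auto simp: s_def t_def e_def min_def)
  \<comment> \<open>\<open>h k\<close> is the horizontal increment as a function of the row; \<open>G\<close> collects what the telescoping
    in \<open>l\<close> leaves.\<close>
  define h where "h k l = v (k+1, l) - v (k, l)" for k l
  define G where "G k = v (k, j) - v (k, 1) + (v (k, j+1) - v (k, j)) * t j" for k
  have "(\<Sum>k=1..N1-1. \<Sum>l=1..N2-1. mixed_diff v k l * (s k * t l)) =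
      (\<Sum>k=1..N1-1. s k * (\<Sum>l=1..N2-1. (h k (l+1) - h k l) * t l))"
    by (simp add: mixed_diff_def h_def sum_distrib_left algebra_simps)
  also have "\<dots> = (\<Sum>k=1..N1-1. (G (k+1) - G k) * s k)"
    unfolding sum_t by (intro sum.cong) (auto simp: G_def h_def algebra_simps)
  also have "\<dots> = G i - G 1 + (G (i+1) - G i) * s i"
    by (rule sum_s)
  finally have bilinear: "(\<Sum>k=1..N1-1. \<Sum>l=1..N2-1. mixed_diff v k l * (s k * t l)) =
      G i - G 1 + (G (i+1) - G i) * s i" .
  have "(\<Sum>k=1..N1-1. \<Sum>l=1..N2-1. mixed_diff v k l * min (s k) (t l)) =
      (\<Sum>k=1..N1-1. \<Sum>l=1..N2-1. mixed_diff v k l * (s k * t l) +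
        (if k = i then if l = j then mixed_diff v i j * e else 0 else 0))"
    by (intro sum.cong refl) (auto simp: min_st algebra_simps)
  also have "\<dots> = (\<Sum>k=1..N1-1. (\<Sum>l=1..N2-1. mixed_diff v k l * (s k * t l)) +
        (if k = i then mixed_diff v i j * e else 0))"
    using j by (intro sum.cong refl) (simp add: sum.distrib)
  also have "\<dots> = G i - G 1 + (G (i+1) - G i) * s i + mixed_diff v i j * e"
    using i by (simp only: sum.distrib bilinear) simp
  finally show ?thesis
    using sum_s[of "\<lambda>k. v (k, 1)"] sum_t[of "\<lambda>l. v (1, l)"]
    by (simp add: pl_interp_def s_def t_def e_def G_def mixed_diff_def algebra_simps)
qed

lemma pl_interp_horizontal_line:
  assumes gy: "is_grid yl yu N2 ys" and j: "j \<in> {1..N2}"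
  shows "pl_interp N1 N2 xs ys v (x, ys j) =
    v (1, j) + (\<Sum>i=1..N1-1. (v (i+1, j) - v (i, j)) * ramp xs i x)"
proof -
  define s where "s k = ramp xs k x" for k
  have "(\<Sum>l=1..N2-1. mixed_diff v k l * min (s k) (ramp ys l (ys j))) =
      s k * (\<Sum>l=1..N2-1. ((v (k+1, l+1) - v (k, l+1)) - (v (k+1, l) - v (k, l))) * ramp ys l (ys j))" for k
    unfolding sum_distrib_left
  proof (rule sum.cong)
    fix l assume "l \<in> {1..N2-1}"
    then show "mixed_diff v k l * min (s k) (ramp ys l (ys j)) =
        s k * (((v (k+1, l+1) - v (k, l+1)) - (v (k+1, l) - v (k, l))) * ramp ys l (ys j))"
      using ramp_at_gridpoint[OF gy j] ramp_bounds[of xs k x]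
      by (auto simp: mixed_diff_def s_def algebra_simps)
  qed simp
  also have "\<dots> k = s k * ((v (k+1, j) - v (k, j)) - (v (k+1, 1) - v (k, 1)))" for k
    by (subst sum_ramp_at_gridpoint[OF gy j]) simp
  finally have inner: "(\<Sum>l=1..N2-1. mixed_diff v k l * min (s k) (ramp ys l (ys j))) =
      s k * ((v (k+1, j) - v (k, j)) - (v (k+1, 1) - v (k, 1)))" for k .
  have "(\<Sum>k=1..N1-1. \<Sum>l=1..N2-1. mixed_diff v k l * min (s k) (ramp ys l (ys j))) =
      (\<Sum>k=1..N1-1. (v (k+1, j) - v (k, j)) * s k) - (\<Sum>k=1..N1-1. (v (k+1, 1) - v (k, 1)) * s k)"
    unfolding inner sum_subtractf[symmetric] by (intro sum.cong refl) (simp add: algebra_simps)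
  moreover have "(\<Sum>l=1..N2-1. (v (1, l+1) - v (1, l)) * ramp ys l (ys j)) = v (1, j) - v (1, 1)"
    by (rule sum_ramp_at_gridpoint[OF gy j])
  ultimately show ?thesis
    by (simp add: pl_interp_def s_def)
qed

lemma pl_interp_vertical_line:
  assumes gx: "is_grid xl xu N1 xs" and i: "i \<in> {1..N1}"
  shows "pl_interp N1 N2 xs ys v (xs i, y) =
    v (i, 1) + (\<Sum>j=1..N2-1. (v (i, j+1) - v (i, j)) * ramp ys j y)"
  by (simp add: pl_interp_swap[of N1] pl_interp_horizontal_line[OF assms])

lemma pl_interp_at_gridpoint:
  assumes gx: "is_grid xl xu N1 xs" and i: "i \<in> {1..N1}"
    and gy: "is_grid yl yu N2 ys" and j: "j \<in> {1..N2}"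
  shows "pl_interp N1 N2 xs ys v (xs i, ys j) = v (i, j)"
  using sum_ramp_at_gridpoint[OF gy j, of "\<lambda>j. v (i, j)"]
  by (simp add: pl_interp_vertical_line[OF gx i])

lemma pl_interp_cong:
  assumes "2 \<le> N1" "2 \<le> N2" and "\<And>i j. i \<in> {1..N1} \<Longrightarrow> j \<in> {1..N2} \<Longrightarrow> v (i, j) = w (i, j)"
  shows "pl_interp N1 N2 xs ys v = pl_interp N1 N2 xs ys w"
proof -
  have eq: "v (1, 1) = w (1, 1)" and
    "\<And>i. i \<in> {1..N1-1} \<Longrightarrow> v (i+1, 1) - v (i, 1) = w (i+1, 1) - w (i, 1)"
    "\<And>j. j \<in> {1..N2-1} \<Longrightarrow> v (1, j+1) - v (1, j) = w (1, j+1) - w (1, j)"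
    "\<And>i j. i \<in> {1..N1-1} \<Longrightarrow> j \<in> {1..N2-1} \<Longrightarrow> mixed_diff v i j = mixed_diff w i j"
    using assms unfolding mixed_diff_def by auto
  then show ?thesis
    unfolding pl_interp_def eq by (auto intro!: ext arg_cong2[where f = "(+)"] sum.cong)
qed

text \<open>
  The two triangles of a cell cover it without overlap, so the two clauses of a Type-1 function
  merge into one value.
\<close>

definition triangle_value ::
  "(nat \<Rightarrow> real) \<Rightarrow> (nat \<Rightarrow> real) \<Rightarrow> (nat \<times> nat \<Rightarrow> real) \<Rightarrow> nat \<Rightarrow> nat \<Rightarrow> real \<times> real \<Rightarrow> real" where
  "triangle_value xs ys v i j q =
     (if q \<in> Delta_l xs ys i j then u_1l xs ys v i j q else u_1u xs ys v i j q)"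

lemma triangle_value_eq_pl_interp:
  assumes gx: "is_grid xl xu N1 xs" and gy: "is_grid yl yu N2 ys"
    and i: "i \<in> {1..N1-1}" and j: "j \<in> {1..N2-1}"
    and q: "q \<in> cell xs ys i j"
  shows "triangle_value xs ys v i j q = pl_interp N1 N2 xs ys v q"
proof -
  obtain x y where q_eq: "q = (x, y)" by fastforce
  define s where "s = (x - xs i) / (xs (i+1) - xs i)"
  define t where "t = (y - ys j) / (ys (j+1) - ys j)"
  have h: "0 < xs (i+1) - xs i" and k: "0 < ys (j+1) - ys j"
    using is_grid_step[OF gx i] is_grid_step[OF gy j] by auto
  have ramps: "ramp xs i x = s" "ramp ys j y = t"
    using q ramp_in_cell[OF gx i] ramp_in_cell[OF gy j] by (auto simp: q_eq cell_def s_def t_def)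
  have "q \<in> Delta_l xs ys i j \<longleftrightarrow> t \<le> s"
    using h k unfolding q_eq Delta_l_def s_def t_def
    by (simp add: divide_le_eq le_divide_eq mult.commute)
  moreover have s': "(xs (i+1) - x) / (xs (i+1) - xs i) = 1 - s"
    and t': "(ys (j+1) - y) / (ys (j+1) - ys j) = 1 - t"
    using h k unfolding s_def t_def by (simp_all add: field_simps)
  have "u_1l xs ys v i j q = (1 - s) * v (i, j) + (s - t) * v (i+1, j) + t * v (i+1, j+1)"
    unfolding q_eq u_1l_def prod.case s' by (simp only: s_def t_def)
  moreover have "u_1u xs ys v i j q = (1 - t) * v (i, j) + (t - s) * v (i, j+1) + s * v (i+1, j+1)"
    unfolding q_eq u_1u_def prod.case t' by (simp only: s_def t_def)
  moreover have "pl_interp N1 N2 xs ys v q = v (i, j) + (v (i+1, j) - v (i, j)) * s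
      + (v (i, j+1) - v (i, j)) * t + mixed_diff v i j * min s t"
    using pl_interp_in_cell[OF gx gy i j] q by (simp only: q_eq ramps)
  ultimately show ?thesis
    by (cases "t \<le> s") (simp_all add: triangle_value_def mixed_diff_def min_absorb1 min_absorb2 algebra_simps)
qed

lemma rectangle_in_cells:
  assumes "is_grid xl xu N1 xs" and "is_grid yl yu N2 ys" and "q \<in> {xl..xu} \<times> {yl..yu}"
  obtains i j where "i \<in> {1..N1-1}" "j \<in> {1..N2-1}" "q \<in> cell xs ys i j"
proof -
  obtain x y where q: "q = (x, y)" "x \<in> {xl..xu}" "y \<in> {yl..yu}"
    using assms(3) by blast
  show thesis
    using cell_side_exists[OF assms(1) q(2)] cell_side_exists[OF assms(2) q(3)] that q(1)
    unfolding cell_def by (metis mem_Sigma_iff)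
qed

lemma cells_in_rectangle:
  assumes "is_grid xl xu N1 xs" and "is_grid yl yu N2 ys" and "i \<in> {1..N1-1}" "j \<in> {1..N2-1}"
  shows "cell xs ys i j \<subseteq> {xl..xu} \<times> {yl..yu}"
proof -
  have side: "cell_side zs k \<subseteq> {a..b}" if "is_grid a b N zs" "k \<in> {1..N-1}" for a b N zs k
  proof -
    have "k \<in> {1..N}" "k + 1 \<in> {1..N}" using that(2) by auto
    then have "zs k \<in> {a..b}" "zs (k+1) \<in> {a..b}"
      using is_grid_in_interval[OF that(1)] by blast+
    then show ?thesis
      by (auto simp: cell_side_def numeral_2_eq_2 split: if_splits)
  qed
  show ?thesis
    using side[OF assms(1,3)] side[OF assms(2,4)] by (auto simp: cell_def)
qed

lemma type1_pl_iff_triangle_value: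
  "type1_pl N1 N2 xs ys u \<longleftrightarrow>
    (\<exists>v. \<forall>i\<in>{1..N1-1}. \<forall>j\<in>{1..N2-1}. \<forall>q\<in>cell xs ys i j. u q = triangle_value xs ys v i j q)"
  unfolding type1_pl_def triangle_value_def Delta_u_def by (intro ex_cong1 ball_cong) auto

lemma type1_pl_iff_pl_interp:
  assumes gx: "is_grid xl xu N1 xs" and gy: "is_grid yl yu N2 ys"
  shows "type1_pl N1 N2 xs ys u \<longleftrightarrow>
    (\<exists>v. \<forall>q\<in>{xl..xu} \<times> {yl..yu}. u q = pl_interp N1 N2 xs ys v q)"
proof -
  have "(\<forall>i\<in>{1..N1-1}. \<forall>j\<in>{1..N2-1}. \<forall>q\<in>cell xs ys i j. u q = triangle_value xs ys v i j q) \<longleftrightarrow>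
      (\<forall>i\<in>{1..N1-1}. \<forall>j\<in>{1..N2-1}. \<forall>q\<in>cell xs ys i j. u q = pl_interp N1 N2 xs ys v q)" for v
    by (intro ball_cong refl) (simp add: triangle_value_eq_pl_interp[OF assms])
  moreover have "(\<forall>i\<in>{1..N1-1}. \<forall>j\<in>{1..N2-1}. \<forall>q\<in>cell xs ys i j. u q = pl_interp N1 N2 xs ys v q) \<longleftrightarrow>
      (\<forall>q\<in>{xl..xu} \<times> {yl..yu}. u q = pl_interp N1 N2 xs ys v q)" for v
  proof (intro iffI ballI)
    fix q assume "\<forall>i\<in>{1..N1-1}. \<forall>j\<in>{1..N2-1}. \<forall>q\<in>cell xs ys i j. u q = pl_interp N1 N2 xs ys v q"
      and "q \<in> {xl..xu} \<times> {yl..yu}"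
    then show "u q = pl_interp N1 N2 xs ys v q"
      using rectangle_in_cells[OF assms, of q] by metis
  next
    fix i j q assume "\<forall>q\<in>{xl..xu} \<times> {yl..yu}. u q = pl_interp N1 N2 xs ys v q"
      and "i \<in> {1..N1-1}" "j \<in> {1..N2-1}" "q \<in> cell xs ys i j"
    then show "u q = pl_interp N1 N2 xs ys v q"
      using cells_in_rectangle[OF assms] by blast
  qed
  ultimately show ?thesis
    by (simp only: type1_pl_iff_triangle_value)
qed

lemma grid_values_pl_interp:
  assumes gx: "is_grid xl xu N1 xs" and gy: "is_grid yl yu N2 ys"
    and "\<And>q. q \<in> {xl..xu} \<times> {yl..yu} \<Longrightarrow> u q = pl_interp N1 N2 xs ys v q"
  shows "grid_values N1 N2 xs ys u = restrict v ({1..N1} \<times> {1..N2})"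
  unfolding grid_values_def
proof (rule restrict_ext)
  fix q assume "q \<in> {1..N1} \<times> {1..N2}"
  then show "(case q of (i, j) \<Rightarrow> u (xs i, ys j)) = v q"
    using is_grid_in_interval[OF gx] is_grid_in_interval[OF gy]
    by (auto simp: assms(3) pl_interp_at_gridpoint[OF gx _ gy])
qed

text \<open>
  A Type-1 function is given by some array of coefficients; interpolation at the gridpoints shows
  that this array consists of the values of the function, hence is unique.
\<close>

lemma type1_pl_eq_pl_interp_grid_values:
  assumes gx: "is_grid xl xu N1 xs" and gy: "is_grid yl yu N2 ys"
    and "type1_pl N1 N2 xs ys u" and q: "q \<in> {xl..xu} \<times> {yl..yu}"
  shows "u q = pl_interp N1 N2 xs ys (grid_values N1 N2 xs ys u) q"
proof -
  obtain v where v: "\<And>q. q \<in> {xl..xu} \<times> {yl..yu} \<Longrightarrow> u q = pl_interp N1 N2 xs ys v q"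
    using assms(3) unfolding type1_pl_iff_pl_interp[OF gx gy] by blast
  have "grid_values N1 N2 xs ys u = restrict v ({1..N1} \<times> {1..N2})"
    by (rule grid_values_pl_interp[OF gx gy]) (rule v)
  then have "pl_interp N1 N2 xs ys (grid_values N1 N2 xs ys u) = pl_interp N1 N2 xs ys v"
    using gx gy by (intro pl_interp_cong) (auto simp: is_grid_def)
  with v[OF q] show ?thesis by simp
qed

lemma sum_over_cells:
  fixes F :: "nat \<Rightarrow> nat \<Rightarrow> real"
  assumes gx: "is_grid xl xu N1 xs" and gy: "is_grid yl yu N2 ys"
    and i: "i \<in> {1..N1-1}" and j: "j \<in> {1..N2-1}" and q: "q \<in> cell xs ys i j"
  shows "(\<Sum>k=1..N1-1. \<Sum>l=1..N2-1. indicat_real (cell xs ys k l) q * F k l) = F i j"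
proof -
  have "indicat_real (cell xs ys k l) q * F k l = (if k = i then if l = j then F i j else 0 else 0)"
    if "k \<in> {1..N1-1}" "l \<in> {1..N2-1}" for k l
    using cell_side_unique[OF gx i _ that(1)] cell_side_unique[OF gy j _ that(2)] q
    by (auto simp: cell_def indicator_def)
  then have "(\<Sum>k=1..N1-1. \<Sum>l=1..N2-1. indicat_real (cell xs ys k l) q * F k l) =
     (\<Sum>k=1..N1-1. if k = i then \<Sum>l=1..N2-1. if l = j then F i j else 0 else 0)"
    by (intro sum.cong refl) auto
  also have "\<dots> = F i j"
    using i j by simp
  finally show ?thesis .
qed

lemma lp_objective_eq:
  assumes gx: "is_grid xl xu N1 xs" and gy: "is_grid yl yu N2 ys"
    and fk: "\<And>k. k \<in> {1..K} \<Longrightarrow> fk k \<in> {xl..xu} \<times> {yl..yu}"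
  shows "lp_objective xs ys N1 N2 K p fk v = (\<Sum>k=1..K. p k * pl_interp N1 N2 xs ys v (fk k))"
  unfolding lp_objective_def
proof (intro sum.cong refl arg_cong2[where f = "(*)"])
  fix k assume "k \<in> {1..K}"
  then obtain i j where ij: "i \<in> {1..N1-1}" "j \<in> {1..N2-1}" "fk k \<in> cell xs ys i j"
    using rectangle_in_cells[OF gx gy fk] by blast
  have "u_1l xs ys v i j q * indicat_real (Delta_l xs ys i j) q +
      u_1u xs ys v i j q * indicat_real (Delta_u xs ys i j) q = triangle_value xs ys v i j q" for i j q
    by (simp add: triangle_value_def Delta_u_def indicator_def)
  then show "(\<Sum>i=1..N1-1. \<Sum>j=1..N2-1. indicat_real (cell xs ys i j) (fk k) *
      (u_1l xs ys v i j (fk k) * indicat_real (Delta_l xs ys i j) (fk k) +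
       u_1u xs ys v i j (fk k) * indicat_real (Delta_u xs ys i j) (fk k))) =
      pl_interp N1 N2 xs ys v (fk k)"
    by (simp only: sum_over_cells[OF gx gy ij] triangle_value_eq_pl_interp[OF gx gy ij])
qed

section \<open>Monotonicity, conservativity, concavity and Lipschitz bounds\<close>

text \<open>
  The shape constraints of the linear program, that is, all but the budget constraints.
\<close>

definition grid_utility ::
  "(nat \<Rightarrow> real) \<Rightarrow> (nat \<Rightarrow> real) \<Rightarrow> nat \<Rightarrow> nat \<Rightarrow> real \<Rightarrow> (nat \<times> nat \<Rightarrow> real) \<Rightarrow> bool" where
  "grid_utility xs ys N1 N2 L v \<longleftrightarrow>
     (\<forall>i\<in>{2..N1-1}. \<forall>j\<in>{1..N2}.
        (v (i+1, j) - v (i, j)) / (xs (i+1) - xs i) \<le> (v (i, j) - v (i-1, j)) / (xs i - xs (i-1))) \<and>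
     (\<forall>i\<in>{1..N1}. \<forall>j\<in>{2..N2-1}.
        (v (i, j+1) - v (i, j)) / (ys (j+1) - ys j) \<le> (v (i, j) - v (i, j-1)) / (ys j - ys (j-1))) \<and>
     (\<forall>i\<in>{1..N1-1}. \<forall>j\<in>{1..N2}. v (i+1, j) - v (i, j) \<le> L * (xs (i+1) - xs i)) \<and>
     (\<forall>i\<in>{1..N1}. \<forall>j\<in>{1..N2-1}. v (i, j+1) - v (i, j) \<le> L * (ys (j+1) - ys j)) \<and>
     (\<forall>i\<in>{1..N1-1}. \<forall>j\<in>{1..N2}. v (i+1, j) \<ge> v (i, j)) \<and>
     (\<forall>i\<in>{1..N1}. \<forall>j\<in>{1..N2-1}. v (i, j+1) \<ge> v (i, j)) \<and>
     (\<forall>i\<in>{1..N1-1}. \<forall>j\<in>{1..N2-1}. v (i, j) + v (i+1, j+1) \<le> v (i, j+1) + v (i+1, j)) \<and>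
     v (1, 1) = 0 \<and> v (N1, N2) = 1"

lemma grid_utility_swap:
  "grid_utility xs ys N1 N2 L v \<Longrightarrow> grid_utility ys xs N2 N1 L (\<lambda>(j, i). v (i, j))"
  unfolding grid_utility_def prod.case by (intro conjI ballI; simp add: add.commute)

lemma concave_on_three_points:
  fixes g :: "real \<Rightarrow> real"
  assumes "concave_on S g" and "p \<in> S" "r \<in> S" and "p < q" "q < r"
  shows "(g r - g q) / (r - q) \<le> (g q - g p) / (q - p)"
proof -
  define w where "w = (q - p) / (r - p)"
  have w: "0 \<le> w" "w \<le> 1" "(1 - w) * p + w * r = q"
    using assms by (auto simp: w_def divide_simps) (simp add: algebra_simps)
  have "(1 - w) * g p + w * g r \<le> g q"
    using concave_onD[OF assms(1) w(1,2) assms(2,3)] w(3) by simp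
  then have "(r - q) * g p + (q - p) * g r \<le> (r - p) * g q"
  proof -
    have "(r - p) * ((1 - w) * g p + w * g r) \<le> (r - p) * g q"
      using \<open>(1 - w) * g p + w * g r \<le> g q\<close> assms(4,5) by (intro mult_left_mono) auto
    moreover have "(r - p) * w = q - p" using assms(4,5) by (simp add: w_def)
    then have "(r - p) * ((1 - w) * g p + w * g r) = (r - q) * g p + (q - p) * g r"
      by algebra
    ultimately show ?thesis by simp
  qed
  then show ?thesis
    using assms(4,5) by (simp add: divide_le_eq le_divide_eq) (simp add: algebra_simps)
qed

lemma mixed_diff_nonpos:
  "grid_utility xs ys N1 N2 L v \<Longrightarrow> i \<in> {1..N1-1} \<Longrightarrow> j \<in> {1..N2-1} \<Longrightarrow> mixed_diff v i j \<le> 0"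
  unfolding grid_utility_def mixed_diff_def by (smt (verit))

lemma min_supermodular:
  fixes s s' t t' :: real
  assumes "s \<le> s'" "t \<le> t'"
  shows "min s t' + min s' t \<le> min s t + min s' t'"
  using assms by (auto simp: min_def)

text \<open>
  The ramp sums in a single variable cancel, so that only the minima contribute.
\<close>

lemma pl_interp_submodular:
  assumes gx: "is_grid xl xu N1 xs" and gy: "is_grid yl yu N2 ys"
    and neg: "\<And>i j. i \<in> {1..N1-1} \<Longrightarrow> j \<in> {1..N2-1} \<Longrightarrow> mixed_diff v i j \<le> 0"
    and "x \<le> x'" "y \<le> y'"
  shows "pl_interp N1 N2 xs ys v (x, y) + pl_interp N1 N2 xs ys v (x', y') \<le>
    pl_interp N1 N2 xs ys v (x, y') + pl_interp N1 N2 xs ys v (x', y)"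
proof -
  define S where "S x y =
    (\<Sum>i=1..N1-1. \<Sum>j=1..N2-1. mixed_diff v i j * min (ramp xs i x) (ramp ys j y))" for x y
  have "S x y + S x' y' \<le> S x y' + S x' y"
    unfolding S_def sum.distrib[symmetric]
  proof (intro sum_mono)
    fix i j assume i: "i \<in> {1..N1-1}" and j: "j \<in> {1..N2-1}"
    have "min (ramp xs i x) (ramp ys j y') + min (ramp xs i x') (ramp ys j y) \<le>
        min (ramp xs i x) (ramp ys j y) + min (ramp xs i x') (ramp ys j y')"
      using assms(4,5) is_grid_step[OF gx i] is_grid_step[OF gy j]
      by (intro min_supermodular ramp_mono)
    from mult_left_mono_neg[OF this neg[OF i j]]
    show "mixed_diff v i j * min (ramp xs i x) (ramp ys j y) +
        mixed_diff v i j * min (ramp xs i x') (ramp ys j y') \<le>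
        mixed_diff v i j * min (ramp xs i x) (ramp ys j y') +
        mixed_diff v i j * min (ramp xs i x') (ramp ys j y)"
      by (simp only: distrib_left)
  qed
  then show ?thesis
    by (simp add: pl_interp_def S_def)
qed

text \<open>
  By submodularity an increment in \<open>x\<close> decreases as \<open>y\<close> grows.  It therefore lies between the increments
  on the upper and on the lower edge, where the grid constraints control it directly.
\<close>

lemma pl_interp_increment_bounds:
  assumes gx: "is_grid xl xu N1 xs" and gy: "is_grid yl yu N2 ys"
    and v: "grid_utility xs ys N1 N2 L v"
    and x: "x \<in> {xl..xu}" "x' \<in> {xl..xu}" "x \<le> x'" and y: "y \<in> {yl..yu}"
  shows "0 \<le> pl_interp N1 N2 xs ys v (x', y) - pl_interp N1 N2 xs ys v (x, y)"
    and "pl_interp N1 N2 xs ys v (x', y) - pl_interp N1 N2 xs ys v (x, y) \<le> L * (x' - x)"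
proof -
  let ?u = "pl_interp N1 N2 xs ys v"
  note submod = pl_interp_submodular[OF gx gy mixed_diff_nonpos[OF v] x(3)]
  have "2 \<le> N1" "2 \<le> N2" and ends: "ys 1 = yl" "ys N2 = yu"
    using gx gy by (auto simp: is_grid_def)
  then have N2: "1 \<in> {1..N2}" "N2 \<in> {1..N2}" by auto
  have step: "ramp xs i x \<le> ramp xs i x'" if "i \<in> {1..N1-1}" for i
    using is_grid_step[OF gx that] x(3) by (rule ramp_mono)
  have "(\<Sum>i=1..N1-1. (v (i+1, N2) - v (i, N2)) * ramp xs i x) \<le>
      (\<Sum>i=1..N1-1. (v (i+1, N2) - v (i, N2)) * ramp xs i x')"
    using v N2 by (intro sum_mono mult_left_mono step) (auto simp: grid_utility_def)
  then have "?u (x, yu) \<le> ?u (x', yu)"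
    using pl_interp_horizontal_line[OF gy N2(2), of N1 xs v] by (simp add: ends)
  with submod[of y yu] y show "0 \<le> ?u (x', y) - ?u (x, y)" by simp
  have "(\<Sum>i=1..N1-1. (v (i+1, 1) - v (i, 1)) * (ramp xs i x' - ramp xs i x)) \<le>
      (\<Sum>i=1..N1-1. (L * (xs (i+1) - xs i)) * (ramp xs i x' - ramp xs i x))"
  proof (intro sum_mono mult_right_mono)
    fix i assume i: "i \<in> {1..N1-1}"
    show "v (i+1, 1) - v (i, 1) \<le> L * (xs (i+1) - xs i)"
      using v i N2(1) unfolding grid_utility_def by blast
    show "0 \<le> ramp xs i x' - ramp xs i x" using step[OF i] by simp
  qed
  also have "\<dots> = L * ((\<Sum>i=1..N1-1. (xs (i+1) - xs i) * ramp xs i x') -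
      (\<Sum>i=1..N1-1. (xs (i+1) - xs i) * ramp xs i x))"
    unfolding sum_subtractf[symmetric] sum_distrib_left
    by (intro sum.cong refl) (simp add: algebra_simps)
  also have "\<dots> = L * (x' - x)"
    by (simp only: sum_width_ramp[OF gx x(1)] sum_width_ramp[OF gx x(2)]) simp
  finally have "?u (x', yl) - ?u (x, yl) \<le> L * (x' - x)"
    using pl_interp_horizontal_line[OF gy N2(1), of N1 xs v]
    by (simp add: ends[simplified] sum_subtractf right_diff_distrib)
  with submod[of yl y] y show "?u (x', y) - ?u (x, y) \<le> L * (x' - x)" by simp
qed

lemma pl_interp_concave_on_grid_line:
  assumes gx: "is_grid xl xu N1 xs" and gy: "is_grid yl yu N2 ys"
    and v: "grid_utility xs ys N1 N2 L v" and j: "j \<in> {1..N2}"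
  shows "concave_on {xl..xu} (\<lambda>x. pl_interp N1 N2 xs ys v (x, ys j))"
  unfolding pl_interp_horizontal_line[OF gy j]
  using v j unfolding grid_utility_def
  by (intro concave_on_add concave_sum_ramp[OF gx, of "\<lambda>i. v (i, j)"])
     (auto simp: concave_on_const)

text \<open>
  Concavity is left as a hypothesis because the two sets of lines on which it is required need
  different arguments.
\<close>

lemma pl_interp_utility_class:
  assumes gx: "is_grid xl xu N1 xs" and gy: "is_grid yl yu N2 ys"
    and v: "grid_utility xs ys N1 N2 L v"
    and concave_x: "\<And>b. b \<in> B \<Longrightarrow> b \<in> {yl..yu} \<and> concave_on {xl..xu} (\<lambda>x. pl_interp N1 N2 xs ys v (x, b))"
    and concave_y: "\<And>a. a \<in> A \<Longrightarrow> a \<in> {xl..xu} \<and> concave_on {yl..yu} (\<lambda>y. pl_interp N1 N2 xs ys v (a, y))"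
  shows "restrict (pl_interp N1 N2 xs ys v) ({xl..xu} \<times> {yl..yu}) \<in> utility_class xl xu yl yu L A B"
proof -
  let ?u = "pl_interp N1 N2 xs ys v"
  have ends: "xs 1 = xl" "xs N1 = xu" "ys 1 = yl" "ys N2 = yu" and "2 \<le> N1" "2 \<le> N2"
    using gx gy by (auto simp: is_grid_def)
  then have N: "1 \<in> {1..N1}" "N1 \<in> {1..N1}" "1 \<in> {1..N2}" "N2 \<in> {1..N2}" by auto
  then have "xl \<le> xu" "yl \<le> yu"
    using is_grid_in_interval[OF gx] is_grid_in_interval[OF gy] by fastforce+
  note incr_x = pl_interp_increment_bounds[OF gx gy v]
  note incr_y = pl_interp_increment_bounds[OF gy gx grid_utility_swap[OF v], folded pl_interp_swap[of N1 N2]]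
  have corners: "?u (xl, yl) = 0" "?u (xu, yu) = 1"
    using pl_interp_at_gridpoint[OF gx _ gy, of 1 1 v] pl_interp_at_gridpoint[OF gx _ gy, of N1 N2 v] N ends v
    by (auto simp: grid_utility_def)
  have range: "?u (x, y) \<in> {0..1}" if "x \<in> {xl..xu}" "y \<in> {yl..yu}" for x y
  proof -
    have "?u (xl, yl) \<le> ?u (x, yl)" "?u (x, yl) \<le> ?u (x, y)"
        "?u (x, y) \<le> ?u (xu, y)" "?u (xu, y) \<le> ?u (xu, yu)"
      using incr_x(1)[of xl x yl] incr_y(1)[of yl y x] incr_x(1)[of x xu y] incr_y(1)[of y yu xu]
        that \<open>xl \<le> xu\<close> \<open>yl \<le> yu\<close> by auto
    then show ?thesis unfolding corners by simp
  qed
  have lip_x: "\<bar>?u (x, y) - ?u (x', y)\<bar> \<le> L * \<bar>x - x'\<bar>"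
    if "x \<in> {xl..xu}" "x' \<in> {xl..xu}" "y \<in> {yl..yu}" for x x' y
    using incr_x[of x x' y] incr_x[of x' x y] that by (cases "x \<le> x'") auto
  have lip_y: "\<bar>?u (x, y) - ?u (x, y')\<bar> \<le> L * \<bar>y - y'\<bar>"
    if "x \<in> {xl..xu}" "y \<in> {yl..yu}" "y' \<in> {yl..yu}" for x y y'
    using incr_y[of y y' x] incr_y[of y' y x] that by (cases "y \<le> y'") auto
  have lip: "\<bar>?u (x, y) - ?u (x', y')\<bar> \<le> L * (\<bar>x - x'\<bar> + \<bar>y - y'\<bar>)"
    if "x \<in> {xl..xu}" "x' \<in> {xl..xu}" "y \<in> {yl..yu}" "y' \<in> {yl..yu}" for x x' y y'
    using lip_x[of x x' y] lip_y[of x' y y'] that by (simp add: distrib_left)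
  have submod: "?u (x, y) + ?u (x', y') \<le> ?u (x, y') + ?u (x', y)" if "x < x'" "y < y'" for x x' y y'
    using that by (intro pl_interp_submodular[OF gx gy mixed_diff_nonpos[OF v]]) auto
  show ?thesis
    unfolding utility_class_def mem_Collect_eq
  proof (intro conjI ballI allI impI)
    show "restrict ?u ({xl..xu} \<times> {yl..yu}) \<in> {xl..xu} \<times> {yl..yu} \<rightarrow>\<^sub>E {0..1}"
      using range by auto
    show "continuous_on ({xl..xu} \<times> {yl..yu}) (restrict ?u ({xl..xu} \<times> {yl..yu}))"
      using continuous_on_pl_interp by (rule continuous_on_eq) simp
    show "mono_on {xl..xu} (\<lambda>x. restrict ?u ({xl..xu} \<times> {yl..yu}) (x, y))" if "y \<in> {yl..yu}" for y
      using incr_x(1)[of _ _ y] that by (auto intro!: mono_onI)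
    show "mono_on {yl..yu} (\<lambda>y. restrict ?u ({xl..xu} \<times> {yl..yu}) (x, y))" if "x \<in> {xl..xu}" for x
      using incr_y(1)[of _ _ x] that by (auto intro!: mono_onI)
    show "concave_on {xl..xu} (\<lambda>x. restrict ?u ({xl..xu} \<times> {yl..yu}) (x, b))" if "b \<in> B" for b
      by (rule concave_on_cong_ivl[OF conjunct2[OF concave_x[OF that]]]) (use concave_x[OF that] in auto)
    show "concave_on {yl..yu} (\<lambda>y. restrict ?u ({xl..xu} \<times> {yl..yu}) (a, y))" if "a \<in> A" for a
      by (rule concave_on_cong_ivl[OF conjunct2[OF concave_y[OF that]]]) (use concave_y[OF that] in auto)
  qed (use corners lip submod \<open>xl \<le> xu\<close> \<open>yl \<le> yu\<close> in auto)
qed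

lemma pl_interp_grid_concave_class:
  assumes gx: "is_grid xl xu N1 xs" and gy: "is_grid yl yu N2 ys"
    and v: "grid_utility xs ys N1 N2 L v"
  shows "restrict (pl_interp N1 N2 xs ys v) ({xl..xu} \<times> {yl..yu})
    \<in> utility_class xl xu yl yu L (xs ` {1..N1}) (ys ` {1..N2})"
proof (rule pl_interp_utility_class[OF assms])
  fix b assume "b \<in> ys ` {1..N2}"
  then show "b \<in> {yl..yu} \<and> concave_on {xl..xu} (\<lambda>x. pl_interp N1 N2 xs ys v (x, b))"
    using is_grid_in_interval[OF gy] pl_interp_concave_on_grid_line[OF assms] by blast
next
  fix a assume "a \<in> xs ` {1..N1}"
  then show "a \<in> {xl..xu} \<and> concave_on {yl..yu} (\<lambda>y. pl_interp N1 N2 xs ys v (a, y))"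
    using is_grid_in_interval[OF gx]
      pl_interp_concave_on_grid_line[OF gy gx grid_utility_swap[OF v], folded pl_interp_swap[of N1 N2]]
    by blast
qed

lemma pl_interp_fully_concave:
  assumes gx: "is_grid xl xu N1 xs" and gy: "is_grid yl yu N2 ys"
    and v: "grid_utility xs ys N1 N2 L v"
    and flat: "\<And>i j. i \<in> {1..N1-1} \<Longrightarrow> j \<in> {1..N2-1} \<Longrightarrow> mixed_diff v i j = 0"
  shows "concave_on {xl..xu} (\<lambda>x. pl_interp N1 N2 xs ys v (x, y))"
proof -
  have one: "1 \<in> {1..N2}" "ys 1 = yl" using gy by (auto simp: is_grid_def)
  have "pl_interp N1 N2 xs ys v (x, y) = pl_interp N1 N2 xs ys v (x, ys 1) +
      (\<Sum>j=1..N2-1. (v (1, j+1) - v (1, j)) * ramp ys j y)" for x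
    using flat pl_interp_horizontal_line[OF gy one(1), of N1 xs v x]
    by (simp add: pl_interp_def)
  then show ?thesis
    using pl_interp_concave_on_grid_line[OF gx gy v one(1)]
    by (simp only:) (intro concave_on_add; simp add: concave_on_const)
qed

lemma pl_interp_fully_concave_class:
  assumes gx: "is_grid xl xu N1 xs" and gy: "is_grid yl yu N2 ys"
    and v: "grid_utility xs ys N1 N2 L v"
    and flat: "\<And>i j. i \<in> {1..N1-1} \<Longrightarrow> j \<in> {1..N2-1} \<Longrightarrow> mixed_diff v i j = 0"
  shows "restrict (pl_interp N1 N2 xs ys v) ({xl..xu} \<times> {yl..yu})
    \<in> utility_class xl xu yl yu L {xl..xu} {yl..yu}"
proof (rule pl_interp_utility_class[OF gx gy v])
  fix b assume "b \<in> {yl..yu}"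
  then show "b \<in> {yl..yu} \<and> concave_on {xl..xu} (\<lambda>x. pl_interp N1 N2 xs ys v (x, b))"
    using pl_interp_fully_concave[OF assms] by blast
next
  have flat': "mixed_diff (\<lambda>(j, i). v (i, j)) j i = 0" if "i \<in> {1..N1-1}" "j \<in> {1..N2-1}" for i j
    using flat[OF that] by (simp add: mixed_diff_def)
  fix a assume "a \<in> {xl..xu}"
  then show "a \<in> {xl..xu} \<and> concave_on {yl..yu} (\<lambda>y. pl_interp N1 N2 xs ys v (a, y))"
    using pl_interp_fully_concave[OF gy gx grid_utility_swap[OF v] flat', folded pl_interp_swap[of N1 N2]]
    by blast
qed

lemma utility_class_grid_values:
  assumes gx: "is_grid xl xu N1 xs" and gy: "is_grid yl yu N2 ys"
    and u: "u \<in> utility_class xl xu yl yu L A B"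
    and "xs ` {1..N1} \<subseteq> A" and "ys ` {1..N2} \<subseteq> B"
  shows "grid_utility xs ys N1 N2 L (grid_values N1 N2 xs ys u)"
proof -
  have ends: "xs 1 = xl" "xs N1 = xu" "ys 1 = yl" "ys N2 = yu" and N: "2 \<le> N1" "2 \<le> N2"
    using gx gy by (auto simp: is_grid_def)
  have val: "grid_values N1 N2 xs ys u (i, j) = u (xs i, ys j)" if "i \<in> {1..N1}" "j \<in> {1..N2}" for i j
    using that by (simp add: grid_values_def)
  note in_x = is_grid_in_interval[OF gx] and in_y = is_grid_in_interval[OF gy]
  have mono_x: "u (x, y) \<le> u (x', y)" if "x \<in> {xl..xu}" "x' \<in> {xl..xu}" "x \<le> x'" "y \<in> {yl..yu}" for x x' y
    using u that unfolding utility_class_def mono_on_def by blast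
  have mono_y: "u (x, y) \<le> u (x, y')" if "y \<in> {yl..yu}" "y' \<in> {yl..yu}" "y \<le> y'" "x \<in> {xl..xu}" for x y y'
    using u that unfolding utility_class_def mono_on_def by blast
  have lip: "\<bar>u (x, y) - u (x', y')\<bar> \<le> L * (\<bar>x - x'\<bar> + \<bar>y - y'\<bar>)"
    if "x \<in> {xl..xu}" "x' \<in> {xl..xu}" "y \<in> {yl..yu}" "y' \<in> {yl..yu}" for x x' y y'
    using u that unfolding utility_class_def by blast
  have conc_x: "concave_on {xl..xu} (\<lambda>x. u (x, ys j))" if "j \<in> {1..N2}" for j
    using u that assms(5) unfolding utility_class_def by blast
  have conc_y: "concave_on {yl..yu} (\<lambda>y. u (xs i, y))" if "i \<in> {1..N1}" for i
    using u that assms(4) unfolding utility_class_def by blast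
  have cons: "u (x, y) + u (x', y') \<le> u (x, y') + u (x', y)"
    if "x \<in> {xl..xu}" "x' \<in> {xl..xu}" "y \<in> {yl..yu}" "y' \<in> {yl..yu}" "x < x'" "y < y'" for x x' y y'
    using u that unfolding utility_class_def by blast
  have norm: "u (xl, yl) = 0" "u (xu, yu) = 1"
    using u unfolding utility_class_def by blast+
  have idx: "i \<in> {1..N}" "i + 1 \<in> {1..N}" if "i \<in> {1..N-1}" for i N :: nat
    using that by auto
  have idx2: "i - 1 \<in> {1..N-1}" "i \<in> {1..N-1}" "i - 1 + 1 = i" if "i \<in> {2..N-1}" for i N :: nat
    using that by auto
  show ?thesis
    unfolding grid_utility_def
  proof (intro conjI ballI)
    fix i j assume i: "i \<in> {2..N1-1}" and j: "j \<in> {1..N2}"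
    note i' = idx[OF idx2(1)[OF i]] idx[OF idx2(2)[OF i]]
    show "(grid_values N1 N2 xs ys u (i+1, j) - grid_values N1 N2 xs ys u (i, j)) / (xs (i+1) - xs i) \<le>
      (grid_values N1 N2 xs ys u (i, j) - grid_values N1 N2 xs ys u (i-1, j)) / (xs i - xs (i-1))"
      unfolding val[OF i'(1) j] val[OF i'(3) j] val[OF i'(4) j]
      using is_grid_step[OF gx idx2(1)[OF i]] is_grid_step[OF gx idx2(2)[OF i]] idx2(3)[OF i]
      by (intro concave_on_three_points[OF conc_x[OF j]] in_x i') simp_all
  next
    fix i j assume i: "i \<in> {1..N1}" and j: "j \<in> {2..N2-1}"
    note j' = idx[OF idx2(1)[OF j]] idx[OF idx2(2)[OF j]]
    show "(grid_values N1 N2 xs ys u (i, j+1) - grid_values N1 N2 xs ys u (i, j)) / (ys (j+1) - ys j) \<le>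
      (grid_values N1 N2 xs ys u (i, j) - grid_values N1 N2 xs ys u (i, j-1)) / (ys j - ys (j-1))"
      unfolding val[OF i j'(1)] val[OF i j'(3)] val[OF i j'(4)]
      using is_grid_step[OF gy idx2(1)[OF j]] is_grid_step[OF gy idx2(2)[OF j]] idx2(3)[OF j]
      by (intro concave_on_three_points[OF conc_y[OF i]] in_y j') simp_all
  next
    fix i j assume i: "i \<in> {1..N1-1}" and j: "j \<in> {1..N2}"
    note i' = idx[OF i]
    show "grid_values N1 N2 xs ys u (i+1, j) - grid_values N1 N2 xs ys u (i, j) \<le> L * (xs (i+1) - xs i)"
      using lip[OF in_x[OF i'(2)] in_x[OF i'(1)] in_y[OF j] in_y[OF j]] is_grid_step[OF gx i]
      unfolding val[OF i'(1) j] val[OF i'(2) j] by simp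
    show "grid_values N1 N2 xs ys u (i, j) \<le> grid_values N1 N2 xs ys u (i+1, j)"
      unfolding val[OF i'(1) j] val[OF i'(2) j]
      using is_grid_step[OF gx i] by (intro mono_x in_x in_y i' j) simp
  next
    fix i j assume i: "i \<in> {1..N1}" and j: "j \<in> {1..N2-1}"
    note j' = idx[OF j]
    show "grid_values N1 N2 xs ys u (i, j+1) - grid_values N1 N2 xs ys u (i, j) \<le> L * (ys (j+1) - ys j)"
      using lip[OF in_x[OF i] in_x[OF i] in_y[OF j'(2)] in_y[OF j'(1)]] is_grid_step[OF gy j]
      unfolding val[OF i j'(1)] val[OF i j'(2)] by simp
    show "grid_values N1 N2 xs ys u (i, j) \<le> grid_values N1 N2 xs ys u (i, j+1)"
      unfolding val[OF i j'(1)] val[OF i j'(2)]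
      using is_grid_step[OF gy j] by (intro mono_y in_x in_y i j') simp
  next
    fix i j assume i: "i \<in> {1..N1-1}" and j: "j \<in> {1..N2-1}"
    note i' = idx[OF i] and j' = idx[OF j]
    show "grid_values N1 N2 xs ys u (i, j) + grid_values N1 N2 xs ys u (i+1, j+1) \<le>
        grid_values N1 N2 xs ys u (i, j+1) + grid_values N1 N2 xs ys u (i+1, j)"
      unfolding val[OF i'(1) j'(1)] val[OF i'(1) j'(2)] val[OF i'(2) j'(1)] val[OF i'(2) j'(2)]
      using is_grid_step[OF gx i] is_grid_step[OF gy j] by (intro cons in_x in_y i' j')
  next
    show "grid_values N1 N2 xs ys u (1, 1) = 0" "grid_values N1 N2 xs ys u (N1, N2) = 1"
      using N ends norm by (auto simp: val)
  qed
qed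

text \<open>
  On the horizontal line through the middle of a cell the function is affine plus \<open>D * min s (1/2)\<close>.
  Concavity across the kink at \<open>s = 1/2\<close> forces \<open>D \<ge> 0\<close>.  The test points 1/4, 1/2, 3/4 avoid the
  left edge, which in general belongs to the neighbouring cell.
\<close>

lemma fully_concave_imp_mixed_diff_nonneg:
  assumes gx: "is_grid xl xu N1 xs" and gy: "is_grid yl yu N2 ys"
    and conc: "\<And>y. y \<in> {yl..yu} \<Longrightarrow> concave_on {xl..xu} (\<lambda>x. pl_interp N1 N2 xs ys v (x, y))"
    and i: "i \<in> {1..N1-1}" and j: "j \<in> {1..N2-1}"
  shows "0 \<le> mixed_diff v i j"
proof -
  define x where "x r = xs i + r * (xs (i+1) - xs i)" for r
  define y where "y = (ys j + ys (j+1)) / 2"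
  have h: "xs i < xs (i+1)" and k: "ys j < ys (j+1)"
    using is_grid_step[OF gx i] is_grid_step[OF gy j] .
  have cell: "(x r, y) \<in> cell xs ys i j" and ramps: "ramp xs i (x r) = r" "ramp ys j y = 1/2"
    if "0 < r" "r \<le> 1" for r
  proof -
    have "r * (xs (i+1) - xs i) \<le> 1 * (xs (i+1) - xs i)" "0 < r * (xs (i+1) - xs i)"
      using h that by (intro mult_right_mono mult_pos_pos; simp)+
    then have "xs i < x r" "x r \<le> xs (i+1)" by (auto simp: x_def)
    moreover have "ys j < y" "y \<le> ys (j+1)" using k by (simp_all add: y_def)
    ultimately show "(x r, y) \<in> cell xs ys i j"
      by (auto simp: cell_def cell_side_def numeral_2_eq_2)
    show "ramp xs i (x r) = r" "ramp ys j y = 1/2"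
      using \<open>xs i < x r\<close> \<open>x r \<le> xs (i+1)\<close> \<open>ys j < y\<close> \<open>y \<le> ys (j+1)\<close> h k
      by (simp_all add: ramp_between) (simp_all add: x_def y_def divide_eq_eq)
  qed
  have u: "pl_interp N1 N2 xs ys v (x r, y) = v (i, j) + (v (i+1, j) - v (i, j)) * r +
      (v (i, j+1) - v (i, j)) * (1/2) + mixed_diff v i j * min r (1/2)" if "0 < r" "r \<le> 1" for r
    unfolding pl_interp_in_cell[OF gx gy i j cell[OF that]] ramps[OF that] ..
  have "(x r, y) \<in> {xl..xu} \<times> {yl..yu}" if "0 < r" "r \<le> 1" for r
    using cells_in_rectangle[OF gx gy i j] cell[OF that] by blast
  from this[of "1/4"] this[of "3/4"] have T: "y \<in> {yl..yu}" "x (1/4) \<in> {xl..xu}" "x (3/4) \<in> {xl..xu}"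
    by auto
  have "x (1/2) = (1 - 1/2) *\<^sub>R x (1/4) + (1/2) *\<^sub>R x (3/4)"
    by (simp add: x_def field_simps)
  then have "(1 - 1/2) * pl_interp N1 N2 xs ys v (x (1/4), y) + (1/2) * pl_interp N1 N2 xs ys v (x (3/4), y)
      \<le> pl_interp N1 N2 xs ys v (x (1/2), y)"
    using concave_onD[OF conc[OF T(1)], of "1/2" "x (1/4)" "x (3/4)"] T by simp
  then show ?thesis
    using u[of "1/4"] u[of "1/2"] u[of "3/4"] by (simp add: field_simps)
qed

section \<open>Integration by parts for the budget integrals\<close>

text \<open>
  The integral against the signed measure \<open>M - N\<close>, as a relation so that linearity and integrability
  are carried along together.
\<close>

definition has_diff_integral :: "'a measure \<Rightarrow> 'a measure \<Rightarrow> ('a \<Rightarrow> real) \<Rightarrow> real \<Rightarrow> bool" where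
  "has_diff_integral M N g I \<longleftrightarrow>
     integrable M g \<and> integrable N g \<and> integral\<^sup>L M g - integral\<^sup>L N g = I"

lemma has_diff_integral_add:
  "has_diff_integral M N g I \<Longrightarrow> has_diff_integral M N g' I' \<Longrightarrow>
    has_diff_integral M N (\<lambda>q. g q + g' q) (I + I')"
  by (auto simp: has_diff_integral_def)

lemma has_diff_integral_mult:
  "has_diff_integral M N g I \<Longrightarrow> has_diff_integral M N (\<lambda>q. c * g q) (c * I)"
  by (auto simp: has_diff_integral_def algebra_simps)

lemma has_diff_integral_sum:
  "(\<And>i. i \<in> S \<Longrightarrow> has_diff_integral M N (g i) (I i)) \<Longrightarrow>
    has_diff_integral M N (\<lambda>q. \<Sum>i\<in>S. g i q) (\<Sum>i\<in>S. I i)"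
  by (auto simp: has_diff_integral_def simp flip: sum_subtractf intro!: sum.cong)

lemma has_diff_integral_cong_AE:
  assumes "has_diff_integral M N g I"
    and "AE q in M. g q = g' q" "AE q in N. g q = g' q"
    and "g' \<in> borel_measurable M" "g' \<in> borel_measurable N"
  shows "has_diff_integral M N g' I"
  using assms integral_cong_AE[of g M g'] integral_cong_AE[of g N g']
    integrable_cong_AE[of g M g'] integrable_cong_AE[of g N g']
  unfolding has_diff_integral_def by (metis borel_measurable_integrable)

text \<open>
  Both sides are iterated integrals of the indicator of \<open>{(q, s). \<gamma> s < q}\<close>, where \<open><\<close> is meant in both
  coordinates.  For fixed \<open>s \<in> {\<alpha>..\<beta>}\<close> the section in \<open>q\<close> is an unbounded quadrant, but up to a null set it
  is the half-open rectangle on which increments of \<open>\<psi>\<close> prescribe the mass.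
\<close>

lemma layer_cake_along_curve:
  fixes M :: "(real \<times> real) measure" and \<gamma>1 \<gamma>2 :: "real \<Rightarrow> real"
  assumes fin: "finite_measure M" and sets_M [measurable_cong]: "sets M = sets borel"
    and null: "emeasure M (- ({xl<..xu} \<times> {yl<..yu})) = 0"
    and [measurable]: "\<gamma>1 \<in> borel_measurable borel" "\<gamma>2 \<in> borel_measurable borel"
    and \<gamma>: "\<And>s. s \<in> {\<alpha>..\<beta>} \<Longrightarrow> xl \<le> \<gamma>1 s \<and> yl \<le> \<gamma>2 s"
  defines "W \<equiv> \<lambda>q. measure lborel {s \<in> {\<alpha>..\<beta>}. \<gamma>1 s < fst q \<and> \<gamma>2 s < snd q}"
    and "V \<equiv> \<lambda>s. indicat_real {\<alpha>..\<beta>} s * measure M ({\<gamma>1 s<..xu} \<times> {\<gamma>2 s<..yu})"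
  shows "integrable M W" "integrable lborel V" "integral\<^sup>L M W = integral\<^sup>L lborel V"
proof -
  interpret M: finite_measure M by (rule fin)
  interpret pair_sigma_finite M lborel ..
  have [measurable]: "(fst :: real \<times> real \<Rightarrow> real) \<in> borel_measurable borel"
      "(snd :: real \<times> real \<Rightarrow> real) \<in> borel_measurable borel"
    by (intro borel_measurable_continuous_onI continuous_intros)+
  have space_M: "space M = UNIV"
    using sets_eq_imp_space_eq[OF sets_M] by simp
  define A where "A = {z \<in> space (M \<Otimes>\<^sub>M lborel). snd z \<in> {\<alpha>..\<beta>} \<and>
      \<gamma>1 (snd z) < fst (fst z) \<and> \<gamma>2 (snd z) < snd (fst z)}"
  have A [measurable]: "A \<in> sets (M \<Otimes>\<^sub>M lborel)"
    unfolding A_def by measurable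
  have "emeasure (M \<Otimes>\<^sub>M lborel) A \<le> emeasure (M \<Otimes>\<^sub>M lborel) (UNIV \<times> {\<alpha>..\<beta>})"
    using sets_M by (intro emeasure_mono) (auto simp: A_def)
  also have "\<dots> = emeasure M UNIV * emeasure lborel {\<alpha>..\<beta>}"
    using sets_M by (intro lborel.emeasure_pair_measure_Times) auto
  also have "\<dots> < \<infinity>"
  proof -
    have "emeasure M UNIV < \<top>" "emeasure lborel {\<alpha>..\<beta>} < \<top>"
      using M.emeasure_finite[of UNIV] by (simp_all add: less_top[symmetric] emeasure_lborel_Icc_eq)
    then show ?thesis by (simp add: ennreal_mult_less_top)
  qed
  finally have int: "integrable (M \<Otimes>\<^sub>M lborel) (\<lambda>(q, s). indicat_real A (q, s))"
    by (simp add: integrable_real_indicator[OF A])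
  have W: "(\<integral>s. indicat_real A (q, s) \<partial>lborel) = W q" for q
  proof -
    have "indicat_real A (q, s) =
        indicat_real {s \<in> {\<alpha>..\<beta>}. \<gamma>1 s < fst q \<and> \<gamma>2 s < snd q} s" for s
      by (simp add: A_def indicator_def space_pair_measure space_M)
    then show ?thesis
      unfolding W_def by simp
  qed
  have V: "(\<integral>q. indicat_real A (q, s) \<partial>M) = V s" for s
  proof (cases "s \<in> {\<alpha>..\<beta>}")
    case True
    have "AE q in M. q \<in> {xl<..xu} \<times> {yl<..yu}"
    proof (rule AE_I[OF _ null])
      have "- ({xl<..xu} \<times> {yl<..yu}) \<in> sets (borel :: (real \<times> real) measure)"
        by (intro borel_comp borel_Times) auto
      then show "- ({xl<..xu} \<times> {yl<..yu}) \<in> sets M" using sets_M by simp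
    qed auto
    then have "AE q in M. indicat_real A (q, s) = indicat_real ({\<gamma>1 s<..xu} \<times> {\<gamma>2 s<..yu}) q"
      by eventually_elim (use True \<gamma>[OF True] in
        \<open>auto simp: A_def indicator_def space_pair_measure space_M\<close>)
    moreover have "{\<gamma>1 s<..xu} \<times> {\<gamma>2 s<..yu} \<in> sets M"
      unfolding sets_M by (intro borel_Times) auto
    ultimately have "(\<integral>q. indicat_real A (q, s) \<partial>M) =
        (\<integral>q. indicat_real ({\<gamma>1 s<..xu} \<times> {\<gamma>2 s<..yu}) q \<partial>M)"
      by (intro integral_cong_AE) auto
    with True show ?thesis by (simp add: V_def space_M)
  next
    case False
    then have "indicat_real A (q, s) = 0" for q
      by (auto simp: A_def indicator_def)
    with False show ?thesis by (simp add: V_def)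
  qed
  show "integrable M W" using integrable_fst[OF int] by (simp add: W)
  show "integrable lborel V" using integrable_snd[OF int] by (simp add: V)
  show "integral\<^sup>L M W = integral\<^sup>L lborel V" using Fubini_integral[OF int] by (simp add: W V)
qed

lemma ls_integral_along_curve:
  fixes \<gamma>1 \<gamma>2 :: "real \<Rightarrow> real"
  assumes rep: "ls_represents xl xu yl yu \<psi> M N"
    and meas: "\<gamma>1 \<in> borel_measurable borel" "\<gamma>2 \<in> borel_measurable borel"
    and \<gamma>: "\<And>s. s \<in> {\<alpha>..\<beta>} \<Longrightarrow> \<gamma>1 s \<in> {xl..xu} \<and> \<gamma>2 s \<in> {yl..yu}"
  shows "has_diff_integral M N
    (\<lambda>q. measure lborel {s \<in> {\<alpha>..\<beta>}. \<gamma>1 s < fst q \<and> \<gamma>2 s < snd q})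
    (LBINT s:{\<alpha>..\<beta>}. rect_incr \<psi> (\<gamma>1 s) xu (\<gamma>2 s) yu)"
proof -
  have low: "xl \<le> \<gamma>1 s \<and> yl \<le> \<gamma>2 s" if "s \<in> {\<alpha>..\<beta>}" for s using \<gamma>[OF that] by simp
  have M: "finite_measure M" "sets M = sets borel" "emeasure M (- ({xl<..xu} \<times> {yl<..yu})) = 0"
    and N: "finite_measure N" "sets N = sets borel" "emeasure N (- ({xl<..xu} \<times> {yl<..yu})) = 0"
    using rep by (auto simp: ls_represents_def)
  note cake_M = layer_cake_along_curve[OF M meas low]
  note cake_N = layer_cake_along_curve[OF N meas low]
  have "(LBINT s:{\<alpha>..\<beta>}. rect_incr \<psi> (\<gamma>1 s) xu (\<gamma>2 s) yu) =
      (\<integral>s. indicat_real {\<alpha>..\<beta>} s * measure M ({\<gamma>1 s<..xu} \<times> {\<gamma>2 s<..yu}) -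
        indicat_real {\<alpha>..\<beta>} s * measure N ({\<gamma>1 s<..xu} \<times> {\<gamma>2 s<..yu}) \<partial>lborel)"
    unfolding set_lebesgue_integral_def
  proof (rule Bochner_Integration.integral_cong[OF refl])
    fix s
    have "rect_incr \<psi> (\<gamma>1 s) xu (\<gamma>2 s) yu = measure M ({\<gamma>1 s<..xu} \<times> {\<gamma>2 s<..yu}) -
        measure N ({\<gamma>1 s<..xu} \<times> {\<gamma>2 s<..yu})" if "s \<in> {\<alpha>..\<beta>}"
      using rep \<gamma>[OF that] by (auto simp: ls_represents_def)
    then show "indicat_real {\<alpha>..\<beta>} s *\<^sub>R rect_incr \<psi> (\<gamma>1 s) xu (\<gamma>2 s) yu =
        indicat_real {\<alpha>..\<beta>} s * measure M ({\<gamma>1 s<..xu} \<times> {\<gamma>2 s<..yu}) -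
        indicat_real {\<alpha>..\<beta>} s * measure N ({\<gamma>1 s<..xu} \<times> {\<gamma>2 s<..yu})"
      by (cases "s \<in> {\<alpha>..\<beta>}") auto
  qed
  then show ?thesis
    unfolding has_diff_integral_def using cake_M cake_N by simp
qed

lemma measure_lborel_Icc_below:
  fixes \<alpha> \<beta> c :: real
  assumes "\<alpha> < \<beta>"
  shows "measure lborel {s \<in> {\<alpha>..\<beta>}. s < c} = (\<beta> - \<alpha>) * max 0 (min 1 ((c - \<alpha>) / (\<beta> - \<alpha>)))"
proof (cases "c \<le> \<beta>")
  case True
  then have eq: "{s \<in> {\<alpha>..\<beta>}. s < c} = {\<alpha>..<c}" by auto
  show ?thesis unfolding eq using True assms
    by (cases "\<alpha> \<le> c") (auto simp: max_def min_def divide_simps)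
next
  case False
  then have "{s \<in> {\<alpha>..\<beta>}. s < c} = {\<alpha>..\<beta>}" by auto
  then show ?thesis using False assms by (auto simp: max_def min_def divide_simps)
qed

lemma diag_measurable: "diag xs ys i j \<in> borel_measurable borel"
  unfolding diag_def[abs_def] by measurable

lemma measure_below_on_edge:
  assumes "xs i < xs (i+1)"
  shows "measure lborel {s \<in> {xs i..xs (i+1)}. s < x} = (xs (i+1) - xs i) * ramp xs i x"
  unfolding ramp_def by (rule measure_lborel_Icc_below[OF assms])

text \<open>
  The diagonal runs through relative coordinates \<open>(r, r)\<close>, and such a point lies strictly below \<open>(x, y)\<close> in
  both coordinates iff \<open>r\<close> is smaller than both relative coordinates of \<open>(x, y)\<close>.
\<close>

lemma measure_below_on_diag:
  assumes h: "xs i < xs (i+1)" and k: "ys j < ys (j+1)"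
  shows "measure lborel {s \<in> {xs i..xs (i+1)}. s < x \<and> diag xs ys i j s < y} =
    (xs (i+1) - xs i) * min (ramp xs i x) (ramp ys j y)"
proof -
  define d where "d = xs i + (xs (i+1) - xs i) * ((y - ys j) / (ys (j+1) - ys j))"
  have "diag xs ys i j s < y \<longleftrightarrow> s < d" for s
  proof -
    have "diag xs ys i j s < y \<longleftrightarrow>
        (ys (j+1) - ys j) * (s - xs i) < (y - ys j) * (xs (i+1) - xs i)"
      using h by (simp add: diag_def field_simps)
    also have "\<dots> \<longleftrightarrow> s < d"
      using k by (simp add: d_def field_simps)
    finally show ?thesis .
  qed
  then have "{s \<in> {xs i..xs (i+1)}. s < x \<and> diag xs ys i j s < y} =
      {s \<in> {xs i..xs (i+1)}. s < min x d}"
    by auto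
  moreover have "(d - xs i) / (xs (i+1) - xs i) = (y - ys j) / (ys (j+1) - ys j)"
    using h by (simp add: d_def)
  moreover have "(min x d - xs i) / (xs (i+1) - xs i) =
      min ((x - xs i) / (xs (i+1) - xs i)) ((d - xs i) / (xs (i+1) - xs i))"
    using h by (auto simp: min_def divide_simps)
  moreover have "max 0 (min 1 (min a b)) = min (max 0 (min 1 a)) (max 0 (min 1 b))" for a b :: real
    by (simp add: min_def max_def)
  ultimately show ?thesis
    using measure_lborel_Icc_below[OF h, of "min x d"] by (simp only: ramp_def)
qed

lemma diag_in_cell:
  assumes h: "xs i < xs (i+1)" and k: "ys j < ys (j+1)" and s: "s \<in> {xs i..xs (i+1)}"
  shows "diag xs ys i j s \<in> {ys j..ys (j+1)}"
proof -
  define r where "r = (s - xs i) / (xs (i+1) - xs i)"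
  have "0 \<le> r" "r \<le> 1" using h s by (auto simp: r_def divide_simps)
  moreover have "diag xs ys i j s = ys j + (ys (j+1) - ys j) * r"
    by (simp add: diag_def r_def)
  moreover have "0 \<le> (ys (j+1) - ys j) * r" "(ys (j+1) - ys j) * r \<le> (ys (j+1) - ys j) * 1"
    using k \<open>0 \<le> r\<close> \<open>r \<le> 1\<close> by (intro mult_left_mono mult_nonneg_nonneg; simp)+
  ultimately show ?thesis by simp
qed

text \<open>
  The left-hand side of the budget constraint of the linear program.
\<close>

definition lp_budget ::
  "(nat \<Rightarrow> real) \<Rightarrow> (nat \<Rightarrow> real) \<Rightarrow> nat \<Rightarrow> nat \<Rightarrow> (real \<times> real \<Rightarrow> real) \<Rightarrow> (nat \<times> nat \<Rightarrow> real) \<Rightarrow> real" where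
  "lp_budget xs ys N1 N2 \<psi> v =
     (\<Sum>i=1..N1-1. \<Sum>j=1..N2-1.
        (v (i+1, j+1) - v (i, j+1) - v (i+1, j) + v (i, j)) / (xs (i+1) - xs i) *
        (LBINT x:{xs i..xs (i+1)}. psi_hat (xs N1) (ys N2) \<psi> x (diag xs ys i j x)))
   + (\<Sum>i=1..N1-1. (v (i+1, 1) - v (i, 1)) / (xs (i+1) - xs i) *
        (LBINT x:{xs i..xs (i+1)}. psi_1 (xs N1) (ys 1) (ys N2) \<psi> x))
   + (\<Sum>j=1..N2-1. (v (1, j+1) - v (1, j)) / (ys (j+1) - ys j) *
        (LBINT y:{ys j..ys (j+1)}. psi_2 (xs 1) (xs N1) (ys N2) \<psi> y))"

text \<open>
  Each summand of \<open>pl_interp\<close> is a normalized length along one of the three kinds of curves.  The edge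
  curves lie on \<open>y = yl\<close> or \<open>x = xl\<close>, so the identity of lengths and ramps needs \<open>yl < y\<close> or
  \<open>xl < x\<close>; the points where this fails carry no mass.
\<close>

lemma ls_integral_pl_interp:
  assumes gx: "is_grid xl xu N1 xs" and gy: "is_grid yl yu N2 ys" and "xl \<le> xu" "yl \<le> yu"
    and "ls_integrator xl xu yl yu \<psi>"
    and u: "\<And>q. q \<in> {xl..xu} \<times> {yl..yu} \<Longrightarrow> u q = pl_interp N1 N2 xs ys v q"
    and zero: "v (1, 1) = 0"
  shows "ls_integral xl xu yl yu u \<psi> = lp_budget xs ys N1 N2 \<psi> v"
proof -
  have ends: "xs 1 = xl" "xs N1 = xu" "ys 1 = yl" "ys N2 = yu"
    using gx gy by (auto simp: is_grid_def)
  have sub_x: "{xs i..xs (i+1)} \<subseteq> {xl..xu}" if "i \<in> {1..N1-1}" for i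
  proof -
    have "i \<in> {1..N1}" "i+1 \<in> {1..N1}" using that by auto
    then show ?thesis using is_grid_in_interval[OF gx] by fastforce
  qed
  have sub_y: "{ys j..ys (j+1)} \<subseteq> {yl..yu}" if "j \<in> {1..N2-1}" for j
  proof -
    have "j \<in> {1..N2}" "j+1 \<in> {1..N2}" using that by auto
    then show ?thesis using is_grid_in_interval[OF gy] by fastforce
  qed
  have diff_int: "has_diff_integral M N (\<lambda>q. indicat_real ({xl..xu} \<times> {yl..yu}) q *\<^sub>R u q)
      (lp_budget xs ys N1 N2 \<psi> v)"
    if rep: "ls_represents xl xu yl yu \<psi> M N" for M N
  proof -
    note curve = ls_integral_along_curve[OF rep]
    have meas_id: "(\<lambda>s::real. s) \<in> borel_measurable borel" by simp
    have meas_const: "(\<lambda>s::real. a) \<in> borel_measurable borel" for a :: real by simp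
    have edge_x: "has_diff_integral M N
        (\<lambda>q. measure lborel {s \<in> {xs i..xs (i+1)}. s < fst q \<and> yl < snd q})
        (LBINT s:{xs i..xs (i+1)}. psi_1 xu yl yu \<psi> s)" if "i \<in> {1..N1-1}" for i
    proof -
      have "s \<in> {xl..xu} \<and> yl \<in> {yl..yu}" if "s \<in> {xs i..xs (i+1)}" for s
        using that sub_x[OF \<open>i \<in> _\<close>] \<open>yl \<le> yu\<close> by auto
      from curve[OF meas_id meas_const this] show ?thesis
        by (simp only: rect_incr_def psi_1_def)
    qed
    have edge_y: "has_diff_integral M N
        (\<lambda>q. measure lborel {s \<in> {ys j..ys (j+1)}. xl < fst q \<and> s < snd q})
        (LBINT s:{ys j..ys (j+1)}. psi_2 xl xu yu \<psi> s)" if "j \<in> {1..N2-1}" for j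
    proof -
      have "xl \<in> {xl..xu} \<and> s \<in> {yl..yu}" if "s \<in> {ys j..ys (j+1)}" for s
        using that sub_y[OF \<open>j \<in> _\<close>] \<open>xl \<le> xu\<close> by auto
      from curve[OF meas_const meas_id this] show ?thesis
        by (simp only: rect_incr_def psi_2_def)
    qed
    have diagonal: "has_diff_integral M N
        (\<lambda>q. measure lborel {s \<in> {xs i..xs (i+1)}. s < fst q \<and> diag xs ys i j s < snd q})
        (LBINT s:{xs i..xs (i+1)}. psi_hat xu yu \<psi> s (diag xs ys i j s))"
      if "i \<in> {1..N1-1}" "j \<in> {1..N2-1}" for i j
    proof -
      have "s \<in> {xl..xu} \<and> diag xs ys i j s \<in> {yl..yu}" if "s \<in> {xs i..xs (i+1)}" for s
        using that sub_x[OF \<open>i \<in> _\<close>] sub_y[OF \<open>j \<in> _\<close>]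
          diag_in_cell[OF is_grid_step[OF gx \<open>i \<in> _\<close>] is_grid_step[OF gy \<open>j \<in> _\<close>] that]
        by blast
      from curve[OF meas_id diag_measurable this] show ?thesis
        by (simp only: rect_incr_def psi_hat_def)
    qed
    define F where "F q =
        (\<Sum>i=1..N1-1. \<Sum>j=1..N2-1. mixed_diff v i j / (xs (i+1) - xs i) *
          measure lborel {s \<in> {xs i..xs (i+1)}. s < fst q \<and> diag xs ys i j s < snd q})
      + (\<Sum>i=1..N1-1. (v (i+1, 1) - v (i, 1)) / (xs (i+1) - xs i) *
          measure lborel {s \<in> {xs i..xs (i+1)}. s < fst q \<and> yl < snd q})
      + (\<Sum>j=1..N2-1. (v (1, j+1) - v (1, j)) / (ys (j+1) - ys j) *
          measure lborel {s \<in> {ys j..ys (j+1)}. xl < fst q \<and> s < snd q})" for q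
    have F: "has_diff_integral M N F (lp_budget xs ys N1 N2 \<psi> v)"
      unfolding F_def lp_budget_def ends mixed_diff_def
      by (intro has_diff_integral_add has_diff_integral_sum has_diff_integral_mult
          edge_x edge_y diagonal)
    have F_eq: "F q = indicat_real ({xl..xu} \<times> {yl..yu}) q *\<^sub>R u q"
      if "q \<in> {xl<..xu} \<times> {yl<..yu}" for q
    proof -
      obtain x y where q: "q = (x, y)" "xl < x" "x \<le> xu" "yl < y" "y \<le> yu"
        using \<open>q \<in> _\<close> by auto
      have "F q = (\<Sum>i=1..N1-1. \<Sum>j=1..N2-1. mixed_diff v i j * min (ramp xs i x) (ramp ys j y))
        + (\<Sum>i=1..N1-1. (v (i+1, 1) - v (i, 1)) * ramp xs i x)
        + (\<Sum>j=1..N2-1. (v (1, j+1) - v (1, j)) * ramp ys j y)"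
        unfolding F_def
      proof (intro arg_cong2[where f = "(+)"] sum.cong refl)
        fix i j assume "i \<in> {1..N1-1}" "j \<in> {1..N2-1}"
        then show "mixed_diff v i j / (xs (i+1) - xs i) *
            measure lborel {s \<in> {xs i..xs (i+1)}. s < fst q \<and> diag xs ys i j s < snd q} =
            mixed_diff v i j * min (ramp xs i x) (ramp ys j y)"
          using is_grid_step[OF gx, of i] is_grid_step[OF gy, of j]
          by (subst measure_below_on_diag) (auto simp: q)
      next
        fix i assume "i \<in> {1..N1-1}"
        then show "(v (i+1, 1) - v (i, 1)) / (xs (i+1) - xs i) *
            measure lborel {s \<in> {xs i..xs (i+1)}. s < fst q \<and> yl < snd q} =
            (v (i+1, 1) - v (i, 1)) * ramp xs i x"
          using is_grid_step[OF gx, of i] measure_below_on_edge[of xs i x] q by simp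
      next
        fix j assume "j \<in> {1..N2-1}"
        then show "(v (1, j+1) - v (1, j)) / (ys (j+1) - ys j) *
            measure lborel {s \<in> {ys j..ys (j+1)}. xl < fst q \<and> s < snd q} =
            (v (1, j+1) - v (1, j)) * ramp ys j y"
          using is_grid_step[OF gy, of j] measure_below_on_edge[of ys j y] q by simp
      qed
      also have "\<dots> = pl_interp N1 N2 xs ys v q"
        using zero by (simp add: pl_interp_def q(1))
      also have "\<dots> = indicat_real ({xl..xu} \<times> {yl..yu}) q *\<^sub>R u q"
        using q u[of q] by auto
      finally show ?thesis .
    qed
    have "AE q in K. F q = indicat_real ({xl..xu} \<times> {yl..yu}) q *\<^sub>R u q"
      and "(\<lambda>q. indicat_real ({xl..xu} \<times> {yl..yu}) q *\<^sub>R u q) \<in> borel_measurable K"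
      if "sets K = sets borel" "emeasure K (- ({xl<..xu} \<times> {yl<..yu})) = 0" for K
    proof -
      have "- ({xl<..xu} \<times> {yl<..yu}) \<in> sets (borel :: (real \<times> real) measure)"
        by (intro borel_comp borel_Times) auto
      then show "AE q in K. F q = indicat_real ({xl..xu} \<times> {yl..yu}) q *\<^sub>R u q"
        using that by (intro AE_I[OF _ that(2)]) (auto simp: F_eq)
      have "(\<lambda>q. indicat_real ({xl..xu} \<times> {yl..yu}) q *\<^sub>R u q) =
          (\<lambda>q. indicat_real ({xl..xu} \<times> {yl..yu}) q * pl_interp N1 N2 xs ys v q)"
        using u by (auto simp: indicator_def)
      also have "\<dots> \<in> borel_measurable borel"
        by (intro borel_measurable_times borel_measurable_indicator borel_Times
            borel_measurable_continuous_onI continuous_on_pl_interp) auto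
      finally show "(\<lambda>q. indicat_real ({xl..xu} \<times> {yl..yu}) q *\<^sub>R u q) \<in> borel_measurable K"
        using measurable_cong_sets[OF that(1) refl] by blast
    qed
    then show ?thesis
      using F rep unfolding ls_represents_def by (intro has_diff_integral_cong_AE[OF F]) auto
  qed
  obtain M0 N0 where rep0: "ls_represents xl xu yl yu \<psi> M0 N0"
    using assms(5) by (auto simp: ls_integrator_def)
  show ?thesis
    unfolding ls_integral_def
  proof (rule the_equality)
    show "\<exists>M N. ls_represents xl xu yl yu \<psi> M N \<and>
        set_integrable M ({xl..xu} \<times> {yl..yu}) u \<and> set_integrable N ({xl..xu} \<times> {yl..yu}) u \<and>
        lp_budget xs ys N1 N2 \<psi> v =
          (LINT p:{xl..xu} \<times> {yl..yu}|M. u p) - (LINT p:{xl..xu} \<times> {yl..yu}|N. u p)"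
      using rep0 diff_int[OF rep0]
      unfolding has_diff_integral_def set_integrable_def set_lebesgue_integral_def
      by (intro exI[of _ M0] exI[of _ N0] conjI) (simp_all only:)
  next
    fix I
    assume "\<exists>M N. ls_represents xl xu yl yu \<psi> M N \<and>
        set_integrable M ({xl..xu} \<times> {yl..yu}) u \<and> set_integrable N ({xl..xu} \<times> {yl..yu}) u \<and>
        I = (LINT p:{xl..xu} \<times> {yl..yu}|M. u p) - (LINT p:{xl..xu} \<times> {yl..yu}|N. u p)"
    then obtain M N where rep: "ls_represents xl xu yl yu \<psi> M N"
      and I: "I = (LINT p:{xl..xu} \<times> {yl..yu}|M. u p) - (LINT p:{xl..xu} \<times> {yl..yu}|N. u p)"
      by (elim exE conjE)
    show "I = lp_budget xs ys N1 N2 \<psi> v"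
      unfolding I set_lebesgue_integral_def
      using diff_int[OF rep] unfolding has_diff_integral_def by (elim conjE)
  qed
qed

section \<open>The reformulation\<close>

lemma reformulates_by_bijection:
  assumes bij: "bij_betw \<phi> S R" and eq: "\<And>u. u \<in> S \<Longrightarrow> h (\<phi> u) = g u"
  shows "reformulates \<phi> S g R h"
proof -
  have R: "R = \<phi> ` S" using bij by (simp add: bij_betw_def)
  have "is_arg_min g (\<lambda>w. w \<in> S) u \<longleftrightarrow> is_arg_min h (\<lambda>w. w \<in> R) (\<phi> u)" if "u \<in> S" for u
    using that eq unfolding is_arg_min_def R by auto
  moreover have "(INF u\<in>S. ereal (g u)) = (INF v\<in>R. ereal (h v))"
    unfolding R image_image by (intro INF_cong) (simp_all add: eq)
  ultimately show ?thesis
    unfolding reformulates_def using bij eq by blast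
qed

lemma lp_feasible_iff:
  "v \<in> lp_feasible xs ys N1 N2 L M \<psi> c \<longleftrightarrow>
     v \<in> ({1..N1} \<times> {1..N2}) \<rightarrow>\<^sub>E UNIV \<and>
     (\<forall>l\<in>{1..M}. lp_budget xs ys N1 N2 (\<psi> l) v \<le> c l) \<and> grid_utility xs ys N1 N2 L v"
  unfolding lp_feasible_def lp_budget_def grid_utility_def mem_Collect_eq ..

lemma reformulates_by_grid_values:
  assumes gx: "is_grid xl xu N1 xs" and gy: "is_grid yl yu N2 ys"
    and fk: "\<And>k. k \<in> {1..K} \<Longrightarrow> fk k \<in> {xl..xu} \<times> {yl..yu}"
    and S: "\<And>u. u \<in> S \<Longrightarrow> u \<in> extensional ({xl..xu} \<times> {yl..yu}) \<and> type1_pl N1 N2 xs ys u \<and>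
      grid_values N1 N2 xs ys u \<in> R"
    and R: "\<And>v. v \<in> R \<Longrightarrow> v \<in> extensional ({1..N1} \<times> {1..N2}) \<and>
      restrict (pl_interp N1 N2 xs ys v) ({xl..xu} \<times> {yl..yu}) \<in> S"
  shows "reformulates (grid_values N1 N2 xs ys) S (\<lambda>u. \<Sum>k=1..K. p k * u (fk k))
    R (lp_objective xs ys N1 N2 K p fk)"
proof (rule reformulates_by_bijection)
  let ?T = "{xl..xu} \<times> {yl..yu}"
  have u_eq: "u q = pl_interp N1 N2 xs ys (grid_values N1 N2 xs ys u) q" if "u \<in> S" "q \<in> ?T" for u q
    using type1_pl_eq_pl_interp_grid_values[OF gx gy _ that(2)] S[OF that(1)] by blast
  show "bij_betw (grid_values N1 N2 xs ys) S R"
  proof (rule bij_betw_byWitness[where f' = "\<lambda>v. restrict (pl_interp N1 N2 xs ys v) ?T"])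
    show "\<forall>u\<in>S. restrict (pl_interp N1 N2 xs ys (grid_values N1 N2 xs ys u)) ?T = u"
    proof
      fix u assume "u \<in> S"
      then show "restrict (pl_interp N1 N2 xs ys (grid_values N1 N2 xs ys u)) ?T = u"
        using S u_eq by (intro extensionalityI[where A = ?T]) auto
    qed
    show "\<forall>v\<in>R. grid_values N1 N2 xs ys (restrict (pl_interp N1 N2 xs ys v) ?T) = v"
    proof
      fix v assume "v \<in> R"
      then have "restrict v ({1..N1} \<times> {1..N2}) = v"
        using R by (simp add: extensional_restrict)
      moreover have "grid_values N1 N2 xs ys (restrict (pl_interp N1 N2 xs ys v) ?T) =
          restrict v ({1..N1} \<times> {1..N2})"
        by (rule grid_values_pl_interp[OF gx gy]) simp
      ultimately show "grid_values N1 N2 xs ys (restrict (pl_interp N1 N2 xs ys v) ?T) = v" by simp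
    qed
  qed (use S R in auto)
  fix u assume "u \<in> S"
  then show "lp_objective xs ys N1 N2 K p fk (grid_values N1 N2 xs ys u) = (\<Sum>k=1..K. p k * u (fk k))"
    using u_eq fk by (subst lp_objective_eq[OF gx gy]) (auto intro!: sum.cong)
qed

lemma type1_pl_restrict_pl_interp:
  assumes "is_grid xl xu N1 xs" and "is_grid yl yu N2 ys"
  shows "type1_pl N1 N2 xs ys (restrict (pl_interp N1 N2 xs ys v) ({xl..xu} \<times> {yl..yu}))"
  unfolding type1_pl_iff_pl_interp[OF assms] by auto

lemma ambiguity_set_grid_values:
  assumes gx: "is_grid xl xu N1 xs" and gy: "is_grid yl yu N2 ys" and "xl \<le> xu" "yl \<le> yu"
    and \<psi>: "\<And>l. l \<in> {1..M} \<Longrightarrow> ls_integrator xl xu yl yu (\<psi> l)"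
    and "xs ` {1..N1} \<subseteq> A" and "ys ` {1..N2} \<subseteq> B"
    and u: "u \<in> ambiguity_set xs ys N1 N2 L A B M \<psi> c"
  shows "u \<in> extensional ({xl..xu} \<times> {yl..yu})" "type1_pl N1 N2 xs ys u"
    "grid_values N1 N2 xs ys u \<in> lp_feasible xs ys N1 N2 L M \<psi> c"
proof -
  have ends: "xs 1 = xl" "xs N1 = xu" "ys 1 = yl" "ys N2 = yu"
    using gx gy by (auto simp: is_grid_def)
  have cls: "u \<in> utility_class xl xu yl yu L A B" and pl: "type1_pl N1 N2 xs ys u"
    and int: "\<And>l. l \<in> {1..M} \<Longrightarrow> ls_integral xl xu yl yu u (\<psi> l) \<le> c l"
    using u unfolding ambiguity_set_def ends by auto
  show "type1_pl N1 N2 xs ys u" by (rule pl)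
  show "u \<in> extensional ({xl..xu} \<times> {yl..yu})"
    using cls unfolding utility_class_def PiE_def by blast
  have grid: "grid_utility xs ys N1 N2 L (grid_values N1 N2 xs ys u)"
    by (rule utility_class_grid_values[OF gx gy cls assms(6,7)])
  then have zero: "grid_values N1 N2 xs ys u (1, 1) = 0"
    unfolding grid_utility_def by blast
  have "ls_integral xl xu yl yu u (\<psi> l) = lp_budget xs ys N1 N2 (\<psi> l) (grid_values N1 N2 xs ys u)"
    if "l \<in> {1..M}" for l
    using type1_pl_eq_pl_interp_grid_values[OF gx gy pl]
    by (intro ls_integral_pl_interp[OF gx gy assms(3,4) \<psi>[OF that]] zero)
  with int grid show "grid_values N1 N2 xs ys u \<in> lp_feasible xs ys N1 N2 L M \<psi> c"
    unfolding lp_feasible_iff by (auto simp: grid_values_def)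
qed

lemma pl_interp_ambiguity_set:
  assumes gx: "is_grid xl xu N1 xs" and gy: "is_grid yl yu N2 ys" and "xl \<le> xu" "yl \<le> yu"
    and \<psi>: "\<And>l. l \<in> {1..M} \<Longrightarrow> ls_integrator xl xu yl yu (\<psi> l)"
    and v: "v \<in> lp_feasible xs ys N1 N2 L M \<psi> c"
    and cls: "restrict (pl_interp N1 N2 xs ys v) ({xl..xu} \<times> {yl..yu}) \<in> utility_class xl xu yl yu L A B"
  shows "restrict (pl_interp N1 N2 xs ys v) ({xl..xu} \<times> {yl..yu}) \<in> ambiguity_set xs ys N1 N2 L A B M \<psi> c"
proof -
  have ends: "xs 1 = xl" "xs N1 = xu" "ys 1 = yl" "ys N2 = yu"
    using gx gy by (auto simp: is_grid_def)
  have zero: "v (1, 1) = 0" using v unfolding lp_feasible_iff grid_utility_def by blast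
  have "ls_integral xl xu yl yu (restrict (pl_interp N1 N2 xs ys v) ({xl..xu} \<times> {yl..yu})) (\<psi> l) =
      lp_budget xs ys N1 N2 (\<psi> l) v" if "l \<in> {1..M}" for l
    by (rule ls_integral_pl_interp[OF gx gy assms(3,4) \<psi>[OF that]]) (use zero in simp_all)
  then show ?thesis
    using cls v type1_pl_restrict_pl_interp[OF gx gy]
    unfolding ambiguity_set_def ends lp_feasible_iff by simp
qed

theorem proposition3p3:
  fixes xl xu yl yu L :: real
    and N1 N2 M K :: nat
    and xs ys c p :: "nat \<Rightarrow> real"
    and \<psi> :: "nat \<Rightarrow> real \<times> real \<Rightarrow> real"
    and f :: "(real ^ 'n) \<times> (real ^ 'm) \<Rightarrow> real \<times> real"
    and Z :: "(real ^ 'n) set" and z :: "real ^ 'n"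
    and P :: "'w measure" and \<xi> :: "'w \<Rightarrow> real ^ 'm" and \<xi>s :: "nat \<Rightarrow> real ^ 'm"
  assumes "xl < xu" and "yl < yu"
    and "is_grid xl xu N1 xs" and "is_grid yl yu N2 ys"
    and "\<And>l. l \<in> {1..M} \<Longrightarrow> ls_integrator xl xu yl yu (\<psi> l)"
    and "continuous_on UNIV f" and "range f \<subseteq> {xl..xu} \<times> {yl..yu}"
    and "compact Z" and "convex Z" and "z \<in> Z"
    and "prob_space P" and "\<xi> \<in> borel_measurable P"
    and "inj_on \<xi>s {1..K}"
    and "\<And>k. k \<in> {1..K} \<Longrightarrow> measure P {\<omega> \<in> space P. \<xi> \<omega> = \<xi>s k} = p k"
    and "(\<Sum>k=1..K. p k) = 1"
  shows
    "reformulates (grid_values N1 N2 xs ys)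
       (ambiguity_set xs ys N1 N2 L (xs ` {1..N1}) (ys ` {1..N2}) M \<psi> c)
       (\<lambda>u. \<Sum>k=1..K. p k * u (f (z, \<xi>s k)))
       (lp_feasible xs ys N1 N2 L M \<psi> c)
       (lp_objective xs ys N1 N2 K p (\<lambda>k. f (z, \<xi>s k)))
     \<and> reformulates (grid_values N1 N2 xs ys)
       (ambiguity_set xs ys N1 N2 L {xl..xu} {yl..yu} M \<psi> c)
       (\<lambda>u. \<Sum>k=1..K. p k * u (f (z, \<xi>s k)))
       {v \<in> lp_feasible xs ys N1 N2 L M \<psi> c.
          \<forall>i\<in>{1..N1-1}. \<forall>j\<in>{1..N2-1}. v (i, j) + v (i+1, j+1) = v (i, j+1) + v (i+1, j)}
       (lp_objective xs ys N1 N2 K p (\<lambda>k. f (z, \<xi>s k)))"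
proof (intro conjI)
  note gx = assms(3) and gy = assms(4)
  have le: "xl \<le> xu" "yl \<le> yu" using assms(1,2) by auto
  note to_lp = ambiguity_set_grid_values[OF gx gy le assms(5)]
  note from_lp = pl_interp_ambiguity_set[OF gx gy le assms(5)]
  have fk: "f (z, \<xi>s k) \<in> {xl..xu} \<times> {yl..yu}" for k
    using assms(7) by blast
  have ext: "v \<in> extensional ({1..N1} \<times> {1..N2})" if "v \<in> lp_feasible xs ys N1 N2 L M \<psi> c" for v
    using that unfolding lp_feasible_iff PiE_def by blast
  have grid: "grid_utility xs ys N1 N2 L v" if "v \<in> lp_feasible xs ys N1 N2 L M \<psi> c" for v
    using that unfolding lp_feasible_iff by blast
  show "reformulates (grid_values N1 N2 xs ys)
       (ambiguity_set xs ys N1 N2 L (xs ` {1..N1}) (ys ` {1..N2}) M \<psi> c)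
       (\<lambda>u. \<Sum>k=1..K. p k * u (f (z, \<xi>s k)))
       (lp_feasible xs ys N1 N2 L M \<psi> c)
       (lp_objective xs ys N1 N2 K p (\<lambda>k. f (z, \<xi>s k)))"
  proof (rule reformulates_by_grid_values[OF gx gy fk])
    fix u assume "u \<in> ambiguity_set xs ys N1 N2 L (xs ` {1..N1}) (ys ` {1..N2}) M \<psi> c"
    from to_lp[OF _ subset_refl subset_refl this]
    show "u \<in> extensional ({xl..xu} \<times> {yl..yu}) \<and> type1_pl N1 N2 xs ys u \<and>
        grid_values N1 N2 xs ys u \<in> lp_feasible xs ys N1 N2 L M \<psi> c" by blast
  next
    fix v assume v: "v \<in> lp_feasible xs ys N1 N2 L M \<psi> c"
    from from_lp[OF _ v pl_interp_grid_concave_class[OF gx gy grid[OF v]]] ext[OF v]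
    show "v \<in> extensional ({1..N1} \<times> {1..N2}) \<and>
        restrict (pl_interp N1 N2 xs ys v) ({xl..xu} \<times> {yl..yu})
        \<in> ambiguity_set xs ys N1 N2 L (xs ` {1..N1}) (ys ` {1..N2}) M \<psi> c" by blast
  qed
  have flat_iff: "v (i, j) + v (i+1, j+1) = v (i, j+1) + v (i+1, j) \<longleftrightarrow> mixed_diff v i j = 0"
    for v i j by (auto simp: mixed_diff_def)
  show "reformulates (grid_values N1 N2 xs ys)
       (ambiguity_set xs ys N1 N2 L {xl..xu} {yl..yu} M \<psi> c)
       (\<lambda>u. \<Sum>k=1..K. p k * u (f (z, \<xi>s k)))
       {v \<in> lp_feasible xs ys N1 N2 L M \<psi> c.
          \<forall>i\<in>{1..N1-1}. \<forall>j\<in>{1..N2-1}. v (i, j) + v (i+1, j+1) = v (i, j+1) + v (i+1, j)}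
       (lp_objective xs ys N1 N2 K p (\<lambda>k. f (z, \<xi>s k)))"
    unfolding flat_iff
  proof (rule reformulates_by_grid_values[OF gx gy fk])
    fix u assume u: "u \<in> ambiguity_set xs ys N1 N2 L {xl..xu} {yl..yu} M \<psi> c"
    have "xs ` {1..N1} \<subseteq> {xl..xu}" "ys ` {1..N2} \<subseteq> {yl..yu}"
      using is_grid_in_interval[OF gx] is_grid_in_interval[OF gy] by blast+
    note lp = to_lp[OF _ this u]
    let ?v = "grid_values N1 N2 xs ys u"
    have conc: "concave_on {xl..xu} (\<lambda>x. pl_interp N1 N2 xs ys ?v (x, y))" if "y \<in> {yl..yu}" for y
    proof (rule concave_on_cong_ivl)
      show "concave_on {xl..xu} (\<lambda>x. u (x, y))"
        using u that gx gy unfolding ambiguity_set_def utility_class_def is_grid_def by auto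
      show "pl_interp N1 N2 xs ys ?v (x, y) = u (x, y)" if "x \<in> {xl..xu}" for x
        using type1_pl_eq_pl_interp_grid_values[OF gx gy lp(2), of "(x, y)"] that \<open>y \<in> _\<close> by simp
    qed
    have "mixed_diff ?v i j = 0" if "i \<in> {1..N1-1}" "j \<in> {1..N2-1}" for i j
      using fully_concave_imp_mixed_diff_nonneg[OF gx gy conc that] mixed_diff_nonpos[OF grid[OF lp(3)] that]
      by (rule antisym[rotated])
    with lp show "u \<in> extensional ({xl..xu} \<times> {yl..yu}) \<and> type1_pl N1 N2 xs ys u \<and>
        ?v \<in> {v \<in> lp_feasible xs ys N1 N2 L M \<psi> c.
          \<forall>i\<in>{1..N1-1}. \<forall>j\<in>{1..N2-1}. mixed_diff v i j = 0}" by blast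
  next
    fix v assume "v \<in> {v \<in> lp_feasible xs ys N1 N2 L M \<psi> c.
          \<forall>i\<in>{1..N1-1}. \<forall>j\<in>{1..N2-1}. mixed_diff v i j = 0}"
    then have v: "v \<in> lp_feasible xs ys N1 N2 L M \<psi> c"
      and flat: "\<And>i j. i \<in> {1..N1-1} \<Longrightarrow> j \<in> {1..N2-1} \<Longrightarrow> mixed_diff v i j = 0" by blast+
    from from_lp[OF _ v pl_interp_fully_concave_class[OF gx gy grid[OF v] flat]] ext[OF v]
    show "v \<in> extensional ({1..N1} \<times> {1..N2}) \<and>
        restrict (pl_interp N1 N2 xs ys v) ({xl..xu} \<times> {yl..yu})
        \<in> ambiguity_set xs ys N1 N2 L {xl..xu} {yl..yu} M \<psi> c" by blast
  qed
qed

end
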